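(* There is a one-sided property testing algorithm for $k$-edge connectivity of directed graphs in the unbounded-degree model with false-reject probability at most $\tfrac13$ that performs $O\big(\tfrac{k^5}{(\epsilon\overline d)^3}\big)$ many queries.
   Context: $G=(V,E)$ is a directed graph with $n$ vertices and $m$ edges; $\overline d=m/n$. Queries are incidence-list queries: the $i$-th outgoing or $i$-th incoming edge of a vertex ($\bot$ if none). A graph is $k$-edge connected if it is strongly connected whenever fewer than $k$ edges are removed. Unbounded-degree model: $G$ is $\epsilon$-far from $k$-edge connectivity if more than $\epsilon n\overline d$ edge modifications are needed to make it $k$-edge connected. A property testing algorithm knows $n$, $m$, is given $\epsilon,k$, and with probability at least $\tfrac23$ accepts every graph with the property and rejects every graph $\epsilon$-far from it; one-sided means graphs with the property are always accepted. *)

theory Defs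
  imports "Graph_Theory.Graph_Theory" "HOL-Probability.Probability_Mass_Function"
begin

text \<open>
  A directed graph is a pair (V, E) with E a finite set of ordered pairs over V (the locale
  \<^locale>\<open>pair_fin_digraph\<close>): there are no parallel edges, whereas loops are permitted.
\<close>

definition avg_degree :: "'a pair_pre_digraph \<Rightarrow> real" where
  "avg_degree G = real (card (parcs G)) / real (card (pverts G))"

definition k_edge_connected :: "nat \<Rightarrow> 'a pair_pre_digraph \<Rightarrow> bool" where
  "k_edge_connected k G \<longleftrightarrow>
     (\<forall>F. F \<subseteq> parcs G \<and> card F < k \<longrightarrow>
        strongly_connected (with_proj (G\<lparr>parcs := parcs G - F\<rparr>)))"

text \<open>
  An edge modification inserts or deletes one edge, so the least number of modifications that turn
  G into H on the same vertices is the size of the symmetric difference of the edge sets.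
  If no graph on the vertex set of G is k-edge connected, then G is far for every \<open>\<epsilon>\<close>.
\<close>

definition far_from_k_edge_connected :: "real \<Rightarrow> nat \<Rightarrow> 'a pair_pre_digraph \<Rightarrow> bool" where
  "far_from_k_edge_connected \<epsilon> k G \<longleftrightarrow>
     (\<forall>H. pair_fin_digraph H \<and> pverts H = pverts G \<and> k_edge_connected k H \<longrightarrow>
        real (card (sym_diff (parcs G) (parcs H))) > \<epsilon> * real (card (pverts G)) * avg_degree G)"

text \<open>
  The \<open>i\<close>-th outgoing (incoming) edge of \<open>v\<close> is reported by its other endpoint, which determines it
  as there are no parallel edges; positions in the lists start at 0. The order of the incidence
  lists is arbitrary.
\<close>

datatype edge_query = Out_Edge nat nat | In_Edge nat nat

definition incidence_lists ::
  "nat pair_pre_digraph \<Rightarrow> (nat \<Rightarrow> nat list) \<Rightarrow> (nat \<Rightarrow> nat list) \<Rightarrow> bool" where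
  "incidence_lists G outs ins \<longleftrightarrow>
     (\<forall>v. distinct (outs v) \<and> set (outs v) = {w. (v, w) \<in> parcs G} \<and>
          distinct (ins v) \<and> set (ins v) = {u. (u, v) \<in> parcs G})"

primrec answer :: "(nat \<Rightarrow> nat list) \<Rightarrow> (nat \<Rightarrow> nat list) \<Rightarrow> edge_query \<Rightarrow> nat option" where
  "answer outs ins (Out_Edge v i) = (if i < length (outs v) then Some (outs v ! i) else None)"
| "answer outs ins (In_Edge v i) = (if i < length (ins v) then Some (ins v ! i) else None)"

text \<open>
  Randomized adaptive query algorithms as trees: halt with a verdict (\<open>True\<close> is accept), ask a query
  and continue depending on the answer, or draw a random number and continue depending on it.
\<close>

datatype query_alg =
    Halt bool
  | Ask edge_query "nat option \<Rightarrow> query_alg"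
  | Draw "nat pmf" "nat \<Rightarrow> query_alg"

text \<open>The joint distribution of the verdict and the number of queries asked.\<close>

primrec run :: "(edge_query \<Rightarrow> nat option) \<Rightarrow> query_alg \<Rightarrow> (bool \<times> nat) pmf" where
  "run orc (Halt b) = return_pmf (b, 0)"
| "run orc (Ask q f) = map_pmf (apsnd Suc) (run orc (f (orc q)))"
| "run orc (Draw p f) = bind_pmf p (\<lambda>x. run orc (f x))"

definition accept_prob :: "(edge_query \<Rightarrow> nat option) \<Rightarrow> query_alg \<Rightarrow> real" where
  "accept_prob orc A = measure_pmf.prob (run orc A) {r. fst r}"

definition reject_prob :: "(edge_query \<Rightarrow> nat option) \<Rightarrow> query_alg \<Rightarrow> real" where
  "reject_prob orc A = measure_pmf.prob (run orc A) {r. \<not> fst r}"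

text \<open>
  \<open>graph_input n m G orc\<close>: \<open>G\<close> has vertex set {0, ..., n - 1} and \<open>m\<close> edges, and \<open>orc\<close> answers the
  queries to \<open>G\<close>. The vertex names are known to an algorithm that knows \<open>n\<close>.
\<close>

definition graph_input ::
  "nat \<Rightarrow> nat \<Rightarrow> nat pair_pre_digraph \<Rightarrow> (edge_query \<Rightarrow> nat option) \<Rightarrow> bool" where
  "graph_input n m G orc \<longleftrightarrow>
     pair_fin_digraph G \<and> pverts G = {..<n} \<and> card (parcs G) = m \<and>
     (\<exists>outs ins. incidence_lists G outs ins \<and> orc = answer outs ins)"

text \<open>The parameters \<open>n\<close>, \<open>m\<close>, \<open>\<epsilon>\<close> and \<open>k\<close> are fixed here; the algorithm \<open>A\<close> may depend on them.\<close>

definition property_tester :: "nat \<Rightarrow> nat \<Rightarrow> real \<Rightarrow> nat \<Rightarrow> query_alg \<Rightarrow> bool" where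
  "property_tester n m \<epsilon> k A \<longleftrightarrow>
     (\<forall>G orc. graph_input n m G orc \<longrightarrow>
        (k_edge_connected k G \<longrightarrow> accept_prob orc A \<ge> 2/3) \<and>
        (far_from_k_edge_connected \<epsilon> k G \<longrightarrow> reject_prob orc A \<ge> 2/3))"

definition one_sided :: "nat \<Rightarrow> nat \<Rightarrow> nat \<Rightarrow> query_alg \<Rightarrow> bool" where
  "one_sided n m k A \<longleftrightarrow>
     (\<forall>G orc. graph_input n m G orc \<longrightarrow> k_edge_connected k G \<longrightarrow> accept_prob orc A = 1)"

definition false_reject_at_most :: "real \<Rightarrow> nat \<Rightarrow> nat \<Rightarrow> nat \<Rightarrow> query_alg \<Rightarrow> bool" where
  "false_reject_at_most p n m k A \<longleftrightarrow>
     (\<forall>G orc. graph_input n m G orc \<longrightarrow> k_edge_connected k G \<longrightarrow> reject_prob orc A \<le> p)"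

text \<open>A worst-case bound: over all inputs with \<open>n\<close> vertices and \<open>m\<close> edges and all random outcomes.\<close>

definition queries_at_most :: "real \<Rightarrow> nat \<Rightarrow> nat \<Rightarrow> query_alg \<Rightarrow> bool" where
  "queries_at_most b n m A \<longleftrightarrow>
     (\<forall>G orc. graph_input n m G orc \<longrightarrow> (\<forall>r \<in> set_pmf (run orc A). real (snd r) \<le> b))"

end

theory Submission
  imports Defs "HOL-Library.Disjoint_Sets"
begin

text \<open>
  Call a proper nonempty vertex set deficient if fewer than \<open>k\<close> edges leave it.

  If neither \<open>G\<close> nor its reverse has more than \<open>p\<close> disjoint deficient sets, then \<open>4 p k\<close> new edges make
  \<open>G\<close> k-edge connected: raise all degrees to \<open>k\<close>, then raise the edge connectivity one by one, with
  \<open>2 p\<close> edges each time, which join the minimal tight sets of the graph and of its reverse to a hub.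
  Hence a far graph, or its reverse, has more than \<open>\<epsilon> m / (4 k)\<close> disjoint deficient sets. At least half of
  these have at most \<open>s = O(k n / (\<epsilon> m))\<close> vertices, and \<open>O(s)\<close> uniform samples hit one of them.

  From a sampled vertex \<open>v\<close> a local search looks for a deficient set \<open>X\<close> with at most \<open>s\<close> elements. As
  there are no parallel edges, vertices of \<open>X\<close> have out-degree less than \<open>s + k\<close>, so exploring a vertex costs at
  most \<open>s + k\<close> queries. The search marks every explored vertex with probability \<open>1 / (4 s)\<close> and sends
  one unit of flow from \<open>v\<close> to each mark. If no vertex of \<open>X\<close> is marked, then after fewer than \<open>k\<close> marks
  the flow saturates \<open>X\<close>, and the residual search is trapped in \<open>X\<close>. This takes \<open>O(k s)\<close> explored
  vertices, so \<open>O(k s (s + k))\<close> queries. Flows need not be computed, since the residual reachability can be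
  expressed through cuts. A rejection is always witnessed by a deficient set.
\<close>

section \<open>Deficient sets and augmentation\<close>

definition cut :: "('a \<times> 'a) set \<Rightarrow> 'a set \<Rightarrow> nat" where
  "cut E X = card {e \<in> E. fst e \<in> X \<and> snd e \<notin> X}"

definition proper_sets :: "'a set \<Rightarrow> 'a set set" where
  "proper_sets V = {X. X \<subseteq> V \<and> X \<noteq> {} \<and> X \<noteq> V}"

definition cuts_ge :: "nat \<Rightarrow> 'a set \<Rightarrow> ('a \<times> 'a) set \<Rightarrow> bool" where
  "cuts_ge k V E \<longleftrightarrow> (\<forall>X\<in>proper_sets V. k \<le> cut E X)"

definition deficient :: "nat \<Rightarrow> 'a set \<Rightarrow> ('a \<times> 'a) set \<Rightarrow> 'a set set" where
  "deficient k V E = {X \<in> proper_sets V. cut E X < k}"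

definition packing_le :: "nat \<Rightarrow> nat \<Rightarrow> 'a set \<Rightarrow> ('a \<times> 'a) set \<Rightarrow> bool" where
  "packing_le p k V E \<longleftrightarrow> (\<forall>F. F \<subseteq> deficient k V E \<and> disjoint F \<longrightarrow> card F \<le> p)"

lemma finite_edges: "finite V \<Longrightarrow> E \<subseteq> V \<times> V \<Longrightarrow> finite E"
  by (meson finite_SigmaI finite_subset)

lemma cut_mono: "finite E' \<Longrightarrow> E \<subseteq> E' \<Longrightarrow> cut E X \<le> cut E' X"
  unfolding cut_def by (rule card_mono) auto

text \<open>An edge leaving \<open>X \<inter> Y\<close> or \<open>X \<union> Y\<close> leaves
  \<open>X\<close> or \<open>Y\<close>, and an edge leaving both of the former leaves both of the
  latter.\<close>

lemma cut_submodular: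
  assumes "finite E"
  shows "cut E (X \<inter> Y) + cut E (X \<union> Y) \<le> cut E X + cut E Y"
proof -
  let ?c = "\<lambda>Z. {e \<in> E. fst e \<in> Z \<and> snd e \<notin> Z}"
  have fin: "finite (?c Z)" for Z
    using assms by simp
  have "cut E (X \<inter> Y) + cut E (X \<union> Y)
      = card (?c (X \<inter> Y) \<union> ?c (X \<union> Y)) + card (?c (X \<inter> Y) \<inter> ?c (X \<union> Y))"
    unfolding cut_def by (rule card_Un_Int[OF fin fin])
  also have "\<dots> \<le> card (?c X \<union> ?c Y) + card (?c X \<inter> ?c Y)"
    by (intro add_mono card_mono finite_UnI finite_Int disjI1 fin) auto
  also have "\<dots> = cut E X + cut E Y"
    unfolding cut_def by (rule card_Un_Int[OF fin fin, symmetric])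
  finally show ?thesis .
qed

lemma cut_converse:
  assumes "E \<subseteq> V \<times> V" "X \<subseteq> V"
  shows "cut (E\<inverse>) X = cut E (V - X)"
proof -
  have "bij_betw prod.swap {e \<in> E. fst e \<in> V - X \<and> snd e \<notin> V - X} {e \<in> E\<inverse>. fst e \<in> X \<and> snd e \<notin> X}"
    using assms by (intro bij_betw_byWitness[where f' = prod.swap]) auto
  then show ?thesis
    unfolding cut_def by (simp add: bij_betw_same_card)
qed

lemma proper_sets_Diff: "X \<in> proper_sets V \<Longrightarrow> V - X \<in> proper_sets V"
  unfolding proper_sets_def by auto

lemma finite_proper_sets: "finite V \<Longrightarrow> finite (proper_sets V)"
  unfolding proper_sets_def by simp

lemma cuts_ge_converse:
  assumes "E \<subseteq> V \<times> V" "cuts_ge k V E"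
  shows "cuts_ge k V (E\<inverse>)"
  unfolding cuts_ge_def
proof
  fix X assume X: "X \<in> proper_sets V"
  then have "cut (E\<inverse>) X = cut E (V - X)"
    by (intro cut_converse[OF assms(1)]) (simp add: proper_sets_def)
  then show "k \<le> cut (E\<inverse>) X"
    using assms(2) proper_sets_Diff[OF X] by (simp add: cuts_ge_def)
qed

text \<open>Additional edges can only shrink the family of deficient sets.\<close>

lemma packing_le_mono:
  assumes "finite E'" "E \<subseteq> E'" "packing_le p k V E"
  shows "packing_le p k V E'"
proof -
  have "deficient k V E' \<subseteq> deficient k V E"
    unfolding deficient_def using cut_mono[OF assms(1,2)] le_less_trans by blast
  then show ?thesis
    using assms(3) unfolding packing_le_def by blast
qed

text \<open>
  Two intersecting minimal tight sets cover \<open>V\<close> by submodularity. Hence the minimal tight sets are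
  pairwise disjoint, or their complements are.
\<close>

lemma card_minimal_tight_sets:
  assumes fin: "finite V" and EV: "E \<subseteq> V \<times> V" and jk: "j < k" and cuts: "cuts_ge j V E"
    and pack: "packing_le p k V E" "packing_le p k V (E\<inverse>)"
    and T_def: "T = {X \<in> proper_sets V. cut E X = j}"
    and M_def: "M = {X \<in> T. \<forall>Y\<in>T. Y \<subseteq> X \<longrightarrow> Y = X}"
  shows "card M \<le> p"
proof -
  have finE: "finite E"
    by (rule finite_edges[OF fin EV])
  have MT: "M \<subseteq> T"
    by (auto simp: M_def)
  have cover: "X \<union> Y = V" if "X \<in> M" "Y \<in> M" "X \<noteq> Y" "X \<inter> Y \<noteq> {}" for X Y
  proof (rule ccontr)
    assume ne: "X \<union> Y \<noteq> V"
    have XY: "X \<in> T" "Y \<in> T"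
      using that MT by auto
    then have ps: "X \<inter> Y \<in> proper_sets V" "X \<union> Y \<in> proper_sets V"
      using that ne by (auto simp: T_def proper_sets_def)
    with cuts have "j \<le> cut E (X \<inter> Y)" "j \<le> cut E (X \<union> Y)"
      by (auto simp: cuts_ge_def)
    with cut_submodular[OF finE, of X Y] XY have "cut E (X \<inter> Y) = j"
      by (auto simp: T_def)
    with ps have "X \<inter> Y \<in> T"
      by (simp add: T_def)
    then have "X \<inter> Y = X" "X \<inter> Y = Y"
      using that by (auto simp: M_def)
    then show False
      using that by auto
  qed
  have sub: "X \<subseteq> V" "X \<noteq> V" if "X \<in> M" for X
    using that by (auto simp: M_def T_def proper_sets_def)
  show ?thesis
  proof (cases "disjoint M")
    case True
    moreover have "M \<subseteq> deficient k V E"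
      using MT jk by (auto simp: T_def deficient_def)
    ultimately show ?thesis
      using pack by (simp add: packing_le_def)
  next
    case False
    then obtain A B where AB: "A \<in> M" "B \<in> M" "A \<noteq> B" "A \<inter> B \<noteq> {}"
      by (auto simp: disjoint_def)
    \<comment> \<open>As \<open>A \<union> B = V\<close>, a member of \<open>M\<close> missing
      \<open>A\<close> lies inside \<open>B\<close> and equals \<open>B\<close> by minimality. So
      one intersecting pair forces every member to meet \<open>A\<close>.\<close>
    have meet_A: "X \<inter> A \<noteq> {}" if "X \<in> M" for X
    proof
      assume *: "X \<inter> A = {}"
      then have "X \<subseteq> B"
        using cover[OF AB] sub[OF that] by auto
      moreover have "X \<in> T"
        using that MT by auto
      ultimately have "X = B"
        using AB by (auto simp: M_def)
      with * AB show False
        by auto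
    qed
    \<comment> \<open>A member \<open>X\<close> other than \<open>A\<close> covers \<open>V\<close>
      together with \<open>A\<close>, so a member missing \<open>X\<close> would lie inside
      \<open>A\<close> and equal it.\<close>
    have meet: "X \<inter> Y \<noteq> {}" if "X \<in> M" "Y \<in> M" for X Y
    proof (cases "X = A")
      case True
      then show ?thesis
        using meet_A[OF that(2)] by auto
    next
      case False
      have XA: "X \<union> A = V"
        using cover[OF that(1) AB(1) False] meet_A[OF that(1)] by auto
      show ?thesis
      proof
        assume *: "X \<inter> Y = {}"
        then have "Y \<subseteq> A"
          using XA sub[OF that(2)] by auto
        moreover have "Y \<in> T"
          using that MT by auto
        ultimately have "Y = A"
          using AB by (auto simp: M_def)
        then show False
          using meet_A[OF that(1)] * by auto
      qed
    qed
    have inj: "inj_on (\<lambda>X. V - X) M"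
      using sub by (auto simp: inj_on_def)
    have "disjoint ((\<lambda>X. V - X) ` M)"
    proof (rule disjoint_family_on_disjoint_image)
      show "disjoint_family_on (\<lambda>X. V - X) M"
        unfolding disjoint_family_on_def
      proof (intro ballI impI)
        fix X Y assume "X \<in> M" "Y \<in> M" "X \<noteq> Y"
        then have "X \<union> Y = V"
          using cover meet by simp
        then show "(V - X) \<inter> (V - Y) = {}"
          by auto
      qed
    qed
    moreover have "(\<lambda>X. V - X) ` M \<subseteq> deficient k V (E\<inverse>)"
    proof
      fix Z assume "Z \<in> (\<lambda>X. V - X) ` M"
      then obtain X where X: "X \<in> T" "Z = V - X"
        using MT by auto
      then have XV: "X \<subseteq> V"
        by (auto simp: T_def proper_sets_def)
      then have "cut (E\<inverse>) Z = cut E X"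
        using X cut_converse[OF EV, of Z] by (simp add: double_diff)
      with X jk show "Z \<in> deficient k V (E\<inverse>)"
        using proper_sets_Diff[of X V] by (auto simp: T_def deficient_def)
    qed
    ultimately have "card ((\<lambda>X. V - X) ` M) \<le> p"
      using pack by (simp add: packing_le_def)
    then show ?thesis
      by (simp add: card_image[OF inj])
  qed
qed

lemma minimal_subset_exists:
  assumes "finite T" "X \<in> T"
  shows "\<exists>Y \<in> {X \<in> T. \<forall>Y\<in>T. Y \<subseteq> X \<longrightarrow> Y = X}. Y \<subseteq> X"
proof -
  have "finite {Y \<in> T. Y \<subseteq> X}" "{Y \<in> T. Y \<subseteq> X} \<noteq> {}"
    using assms by auto
  from finite_has_minimal[OF this] obtain Y where Y: "Y \<in> T" "Y \<subseteq> X"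
    and min: "\<And>Z. Z \<in> T \<Longrightarrow> Z \<subseteq> X \<Longrightarrow> Z \<subseteq> Y \<Longrightarrow> Y = Z"
    by auto
  then have "\<forall>Z\<in>T. Z \<subseteq> Y \<longrightarrow> Z = Y"
    by (metis subset_trans)
  with Y show ?thesis
    by auto
qed

text \<open>
  Otherwise \<open>k\<close> out-neighbours of a vertex of \<open>X\<close> inject into the edges leaving \<open>X\<close>: a neighbour
  outside \<open>X\<close> is reached by such an edge, and a neighbour inside is the tail of another one.
\<close>

lemma vertex_without_leaving_edge:
  assumes finE: "finite E" and deg: "\<And>v. v \<in> V \<Longrightarrow> k \<le> cut E {v}"
    and X: "X \<in> deficient k V E"
  shows "\<exists>x\<in>X. \<forall>y. (x, y) \<in> E \<longrightarrow> y \<in> X"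
proof (rule ccontr)
  assume "\<not> ?thesis"
  then have "\<forall>x\<in>X. \<exists>y. (x, y) \<in> E \<and> y \<notin> X"
    by blast
  then obtain g where g: "\<And>x. x \<in> X \<Longrightarrow> (x, g x) \<in> E \<and> g x \<notin> X"
    by metis
  obtain v where v: "v \<in> X" "v \<in> V"
    using X by (auto simp: deficient_def proper_sets_def)
  let ?N = "{e \<in> E. fst e \<in> {v} \<and> snd e \<notin> {v}}"
  let ?h = "\<lambda>e. if snd e \<in> X then (snd e, g (snd e)) else e"
  have "inj_on ?h ?N"
    by (auto simp: inj_on_def split: if_splits)
  moreover have "?h ` ?N \<subseteq> {e \<in> E. fst e \<in> X \<and> snd e \<notin> X}"
  proof
    fix e assume "e \<in> ?h ` ?N"
    then obtain d where d: "d \<in> ?N" "e = ?h d"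
      by blast
    then show "e \<in> {e \<in> E. fst e \<in> X \<and> snd e \<notin> X}"
      using g[of "snd d"] v(1) by (cases "snd d \<in> X") auto
  qed
  moreover have "finite {e \<in> E. fst e \<in> X \<and> snd e \<notin> X}"
    using finE by simp
  ultimately have "card ?N \<le> cut E X"
    unfolding cut_def by (rule card_inj_on_le)
  then have "k \<le> cut E X"
    using deg[OF v(2)] by (simp add: cut_def)
  with X show False
    by (simp add: deficient_def)
qed

text \<open>
  The hub \<open>c\<close> is arbitrary. A tight set avoiding \<open>c\<close> contains a minimal one, which now sends an edge
  to \<open>c\<close>; if a tight set contains \<open>c\<close>, the same applies to its complement with all edges reversed.
\<close>

lemma increase_cuts:
  assumes fin: "finite V" and ne: "V \<noteq> {}" and EV: "E \<subseteq> V \<times> V" and jk: "j < k"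
    and cuts: "cuts_ge j V E"
    and deg: "\<And>v. v \<in> V \<Longrightarrow> k \<le> cut E {v}" "\<And>v. v \<in> V \<Longrightarrow> k \<le> cut (E\<inverse>) {v}"
    and pack: "packing_le p k V E" "packing_le p k V (E\<inverse>)"
  shows "\<exists>E'. E \<subseteq> E' \<and> E' \<subseteq> V \<times> V \<and> card (E' - E) \<le> 2 * p \<and> cuts_ge (Suc j) V E'"
proof -
  define tight where "tight E = {X \<in> proper_sets V. cut E X = j}" for E
  define mins where "mins E = {X \<in> tight E. \<forall>Y\<in>tight E. Y \<subseteq> X \<longrightarrow> Y = X}" for E
  have finE: "finite E"
    by (rule finite_edges[OF fin EV])
  have EV': "E\<inverse> \<subseteq> V \<times> V"
    using EV by auto
  obtain c where c: "c \<in> V"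
    using ne by auto
  \<comment> \<open>Stated for a fresh \<open>E\<close>, because it is applied to the graph and to
    its reverse.\<close>
  have key: "\<exists>S. S \<subseteq> V \<and> card S \<le> p \<and>
      (\<forall>X\<in>tight E. c \<notin> X \<longrightarrow> (\<exists>x\<in>S \<inter> X. (x, c) \<notin> E))"
    if EV: "E \<subseteq> V \<times> V" and cuts: "cuts_ge j V E"
    and deg: "\<And>v. v \<in> V \<Longrightarrow> k \<le> cut E {v}"
    and pack: "packing_le p k V E" "packing_le p k V (E\<inverse>)" for E
  proof -
    have finE: "finite E"
      by (rule finite_edges[OF fin EV])
    \<comment> \<open>An edge already present would not raise the cut. A vertex all of whose edges
      stay in the minimal set guarantees that its edge to a hub outside is new.\<close>
    have "\<forall>X\<in>mins E. \<exists>x. x \<in> X \<and> (\<forall>y. (x, y) \<in> E \<longrightarrow> y \<in> X)"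
    proof
      fix X assume "X \<in> mins E"
      then have "X \<in> deficient k V E"
        using jk by (auto simp: mins_def tight_def deficient_def)
      from vertex_without_leaving_edge[OF finE deg this]
      show "\<exists>x. x \<in> X \<and> (\<forall>y. (x, y) \<in> E \<longrightarrow> y \<in> X)"
        by blast
    qed
    from bchoice[OF this] obtain f where f: "\<forall>X\<in>mins E. f X \<in> X \<and> (\<forall>y. (f X, y) \<in> E \<longrightarrow> y \<in> X)"
      by blast
    have finT: "finite (tight E)"
      using finite_proper_sets[OF fin] by (simp add: tight_def)
    then have finM: "finite (mins E)"
      by (simp add: mins_def)
    have "card (mins E) \<le> p"
      by (rule card_minimal_tight_sets[OF fin EV jk cuts pack tight_def mins_def])
    then have "card (f ` mins E) \<le> p"
      using card_image_le[OF finM, of f] by linarith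
    moreover have "f ` mins E \<subseteq> V"
      using f by (auto simp: mins_def tight_def proper_sets_def)
    moreover have "\<exists>x\<in>f ` mins E \<inter> X. (x, c) \<notin> E" if X: "X \<in> tight E" and cX: "c \<notin> X" for X
    proof -
      obtain Y where Y: "Y \<in> mins E" "Y \<subseteq> X"
        using minimal_subset_exists[OF finT X] by (auto simp: mins_def)
      with f cX have "f Y \<in> X" "(f Y, c) \<notin> E"
        by auto
      with Y show ?thesis
        by blast
    qed
    ultimately show ?thesis
      by blast
  qed
  obtain S where S: "S \<subseteq> V" "card S \<le> p"
    and S_out: "\<And>X. X \<in> tight E \<Longrightarrow> c \<notin> X \<Longrightarrow> \<exists>x\<in>S \<inter> X. (x, c) \<notin> E"
    using key[OF EV cuts deg(1) pack] by blast
  obtain R where R: "R \<subseteq> V" "card R \<le> p"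
    and R_in: "\<And>X. X \<in> tight (E\<inverse>) \<Longrightarrow> c \<notin> X \<Longrightarrow> \<exists>x\<in>R \<inter> X. (x, c) \<notin> E\<inverse>"
    using key[OF EV' cuts_ge_converse[OF EV cuts] deg(2) pack(2)] pack(1) by auto
  let ?E' = "E \<union> (S \<times> {c} \<union> {c} \<times> R)"
  have finE': "finite ?E'"
    using finE finite_subset[OF S(1) fin] finite_subset[OF R(1) fin] by simp
  have "card (?E' - E) \<le> card (S \<times> {c} \<union> {c} \<times> R)"
    using finite_subset[OF S(1) fin] finite_subset[OF R(1) fin] by (intro card_mono) auto
  also have "\<dots> \<le> card (S \<times> {c}) + card ({c} \<times> R)"
    by (rule card_Un_le)
  also have "\<dots> \<le> 2 * p"
    using S(2) R(2) by (simp add: card_cartesian_product)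
  finally have "card (?E' - E) \<le> 2 * p" .
  moreover have "cuts_ge (Suc j) V ?E'"
    unfolding cuts_ge_def
  proof
    fix X assume X: "X \<in> proper_sets V"
    show "Suc j \<le> cut ?E' X"
    proof (cases "cut E X = j")
      case False
      then have "Suc j \<le> cut E X"
        using cuts X by (force simp: cuts_ge_def)
      then show ?thesis
        using cut_mono[OF finE', of E X] by auto
    next
      case True
      have "\<exists>e\<in>?E' - E. fst e \<in> X \<and> snd e \<notin> X"
      proof (cases "c \<in> X")
        case False
        have "X \<in> tight E"
          using X True by (simp add: tight_def)
        from S_out[OF this False] obtain x where "x \<in> S" "x \<in> X" "(x, c) \<notin> E"
          by blast
        with False show ?thesis
          by (intro bexI[of _ "(x, c)"]) auto
      next
        case c_in: True
        have XV: "X \<subseteq> V"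
          using X by (auto simp: proper_sets_def)
        have "cut (E\<inverse>) (V - X) = j"
          using cut_converse[OF EV, of "V - X"] XV True by (simp add: double_diff)
        then have "V - X \<in> tight (E\<inverse>)"
          using proper_sets_Diff[OF X] by (simp add: tight_def)
        from R_in[OF this] c_in obtain y where "y \<in> R" "y \<in> V - X" "(c, y) \<notin> E"
          by auto
        with c_in show ?thesis
          by (intro bexI[of _ "(c, y)"]) auto
      qed
      then obtain e where e: "e \<in> ?E' - E" "fst e \<in> X" "snd e \<notin> X"
        by blast
      then have "{e \<in> E. fst e \<in> X \<and> snd e \<notin> X} \<subset> {e \<in> ?E'. fst e \<in> X \<and> snd e \<notin> X}"
        by blast
      then have "cut E X < cut ?E' X"
        unfolding cut_def using finE' by (intro psubset_card_mono) auto
      with True show ?thesis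
        by simp
    qed
  qed
  moreover have "?E' \<subseteq> V \<times> V"
    using EV S(1) R(1) c by auto
  ultimately show ?thesis
    by blast
qed

text \<open>Packing and degree bounds survive the insertion of edges, so \<open>p\<close> stays the
  same in all \<open>j\<close> rounds, each of which adds at most \<open>2 * p\<close>
  edges.\<close>

lemma increase_cuts_iterated:
  assumes fin: "finite V" and ne: "V \<noteq> {}" and EV: "E \<subseteq> V \<times> V" and jk: "j \<le> k"
    and deg: "\<And>v. v \<in> V \<Longrightarrow> k \<le> cut E {v}" "\<And>v. v \<in> V \<Longrightarrow> k \<le> cut (E\<inverse>) {v}"
    and pack: "packing_le p k V E" "packing_le p k V (E\<inverse>)"
  shows "\<exists>E'. E \<subseteq> E' \<and> E' \<subseteq> V \<times> V \<and> card (E' - E) \<le> 2 * p * j \<and> cuts_ge j V E'"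
  using jk
proof (induction j)
  case 0
  then show ?case
    using EV by (intro exI[of _ E]) (auto simp: cuts_ge_def)
next
  case (Suc j)
  then obtain E1 where E1: "E \<subseteq> E1" "E1 \<subseteq> V \<times> V" "card (E1 - E) \<le> 2 * p * j" "cuts_ge j V E1"
    by auto
  have fin1: "finite E1" "finite (E1\<inverse>)"
    using finite_edges[OF fin E1(2)] by simp_all
  have conv: "E\<inverse> \<subseteq> E1\<inverse>"
    using E1(1) by auto
  have deg1: "k \<le> cut E1 {v}" "k \<le> cut (E1\<inverse>) {v}" if "v \<in> V" for v
    using deg[OF that] cut_mono[OF fin1(1) E1(1), of "{v}"] cut_mono[OF fin1(2) conv, of "{v}"]
    by auto
  have "\<exists>E'. E1 \<subseteq> E' \<and> E' \<subseteq> V \<times> V \<and> card (E' - E1) \<le> 2 * p \<and> cuts_ge (Suc j) V E'"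
    using Suc.prems by (intro increase_cuts[OF fin ne E1(2) _ E1(4) deg1
          packing_le_mono[OF fin1(1) E1(1) pack(1)] packing_le_mono[OF fin1(2) conv pack(2)]]) auto
  then obtain E2 where E2: "E1 \<subseteq> E2" "E2 \<subseteq> V \<times> V" "card (E2 - E1) \<le> 2 * p" "cuts_ge (Suc j) V E2"
    by blast
  have "card (E2 - E) \<le> card ((E1 - E) \<union> (E2 - E1))"
    using finite_edges[OF fin E1(2)] finite_edges[OF fin E2(2)] by (intro card_mono) auto
  also have "\<dots> \<le> card (E1 - E) + card (E2 - E1)"
    by (rule card_Un_le)
  finally have "card (E2 - E) \<le> 2 * p * Suc j"
    using E1(3) E2(3) by simp
  with E1(1) E2 show ?case
    by blast
qed

text \<open>The singletons of vertices with too few edges to other vertices form a packing, so there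
  are at most \<open>p\<close> of them. Each is joined to \<open>k\<close> others, some of which may
  already be its neighbours.\<close>

lemma increase_out_degrees:
  assumes fin: "finite V" and EV: "E \<subseteq> V \<times> V" and k: "k < card V"
    and pack: "packing_le p k V E"
  shows "\<exists>D. D \<subseteq> V \<times> V \<and> card D \<le> p * k \<and> (\<forall>v\<in>V. k \<le> cut (E \<union> D) {v})"
proof (cases "k = 0")
  case True
  then show ?thesis
    by (intro exI[of _ "{}"]) auto
next
  case False
  define S where "S = {v \<in> V. cut E {v} < k}"
  have finS: "finite S"
    using fin by (simp add: S_def)
  \<comment> \<open>Here \<open>1 \<le> k < card V\<close>, so a singleton is a proper
    subset.\<close>
  have "(\<lambda>v. {v}) ` S \<subseteq> deficient k V E"
    using k False by (auto simp: S_def deficient_def proper_sets_def)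
  moreover have "disjoint ((\<lambda>v. {v}) ` S)"
    by (auto simp: disjoint_def)
  ultimately have "card ((\<lambda>v. {v}) ` S) \<le> p"
    using pack by (auto simp: packing_le_def)
  then have cardS: "card S \<le> p"
    by (simp add: card_image)
  have "\<exists>W. W \<subseteq> V - {v} \<and> card W = k" if "v \<in> S" for v
  proof -
    have "k \<le> card (V - {v})"
      using k that fin by (simp add: S_def)
    then show ?thesis
      by (meson obtain_subset_with_card_n)
  qed
  then obtain W where W: "\<And>v. v \<in> S \<Longrightarrow> W v \<subseteq> V - {v} \<and> card (W v) = k"
    by metis
  define D where "D = Sigma S W"
  have DV: "D \<subseteq> V \<times> V"
    using W by (auto simp: D_def S_def)
  have finD: "finite (E \<union> D)"
    using finite_edges[OF fin EV] finite_edges[OF fin DV] by simp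
  have finW: "finite (W v)" if "v \<in> S" for v
    by (rule finite_subset[OF conjunct1[OF W[OF that]]]) (simp add: fin)
  have "card D = (\<Sum>v\<in>S. card (W v))"
    unfolding D_def using finS finW by (intro card_SigmaI) auto
  then have "card D \<le> p * k"
    using W cardS by simp
  moreover have "k \<le> cut (E \<union> D) {v}" if v: "v \<in> V" for v
  proof (cases "v \<in> S")
    case True
    have "k = card (Pair v ` W v)"
      using W[OF True] by (simp add: card_image inj_on_def)
    also have "\<dots> \<le> cut (E \<union> D) {v}"
      unfolding cut_def using finD W[OF True] True by (intro card_mono) (auto simp: D_def)
    finally show ?thesis .
  next
    case False
    then have "k \<le> cut E {v}"
      using v by (simp add: S_def)
    also have "\<dots> \<le> cut (E \<union> D) {v}"
      by (rule cut_mono[OF finD]) simp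
    finally show ?thesis .
  qed
  ultimately show ?thesis
    using DV by blast
qed

text \<open>The bound splits into \<open>p * k\<close> edges for the out-degrees,
  \<open>p * k\<close> for the in-degrees and \<open>2 * p * k\<close> for raising the cuts from 0
  to \<open>k\<close>.\<close>

theorem augmentation:
  assumes fin: "finite V" and EV: "E \<subseteq> V \<times> V" and k: "k < card V"
    and pack: "packing_le p k V E" "packing_le p k V (E\<inverse>)"
  shows "\<exists>E'. E \<subseteq> E' \<and> E' \<subseteq> V \<times> V \<and> card (E' - E) \<le> 4 * p * k \<and> cuts_ge k V E'"
proof -
  have EV': "E\<inverse> \<subseteq> V \<times> V"
    using EV by auto
  obtain D where D: "D \<subseteq> V \<times> V" "card D \<le> p * k" "\<And>v. v \<in> V \<Longrightarrow> k \<le> cut (E \<union> D) {v}"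
    using increase_out_degrees[OF fin EV k pack(1)] by blast
  obtain C where C: "C \<subseteq> V \<times> V" "card C \<le> p * k" "\<And>v. v \<in> V \<Longrightarrow> k \<le> cut (E\<inverse> \<union> C) {v}"
    using increase_out_degrees[OF fin EV' k pack(2)] by blast
  define E1 where "E1 = E \<union> (D \<union> C\<inverse>)"
  have E1V: "E1 \<subseteq> V \<times> V"
    using EV D(1) C(1) by (auto simp: E1_def)
  have fin1: "finite E1" "finite (E1\<inverse>)"
    using finite_edges[OF fin E1V] by simp_all
  have sub: "E \<subseteq> E1" "E\<inverse> \<subseteq> E1\<inverse>" "E \<union> D \<subseteq> E1" "E\<inverse> \<union> C \<subseteq> E1\<inverse>"
    by (auto simp: E1_def)
  have deg: "k \<le> cut E1 {v}" "k \<le> cut (E1\<inverse>) {v}" if "v \<in> V" for v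
    using D(3)[OF that] C(3)[OF that] cut_mono[OF fin1(1) sub(3), of "{v}"]
      cut_mono[OF fin1(2) sub(4), of "{v}"] by auto
  have "V \<noteq> {}"
    using k by auto
  then obtain E2 where E2: "E1 \<subseteq> E2" "E2 \<subseteq> V \<times> V" "card (E2 - E1) \<le> 2 * p * k" "cuts_ge k V E2"
    using increase_cuts_iterated[OF fin _ E1V le_refl deg
        packing_le_mono[OF fin1(1) sub(1) pack(1)] packing_le_mono[OF fin1(2) sub(2) pack(2)]]
    by blast
  have finU: "finite (D \<union> C\<inverse>)" "finite (E2 - E1)"
    using finite_edges[OF fin D(1)] finite_edges[OF fin C(1)] finite_edges[OF fin E2(2)] by simp_all
  have "card (E2 - E) \<le> card ((D \<union> C\<inverse>) \<union> (E2 - E1))"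
    using finU by (intro card_mono) (auto simp: E1_def)
  also have "\<dots> \<le> card D + card (C\<inverse>) + card (E2 - E1)"
    using card_Un_le[of D "C\<inverse>"] card_Un_le[of "D \<union> C\<inverse>" "E2 - E1"] by linarith
  also have "\<dots> \<le> 4 * p * k"
    using D(2) C(2) E2(3) by (simp add: card_inverse)
  finally have "card (E2 - E) \<le> 4 * p * k" .
  with E2 sub(1) show ?thesis
    by blast
qed

section \<open>Edge connectivity as a condition on cuts\<close>

lemma k_edge_connected_iff_cuts_ge:
  assumes "pair_fin_digraph G" and ne: "pverts G \<noteq> {}"
  shows "k_edge_connected k G \<longleftrightarrow> cuts_ge k (pverts G) (parcs G)"
proof
  interpret pair_fin_digraph G by fact
  assume L: "k_edge_connected k G"
  show "cuts_ge k (pverts G) (parcs G)"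
    unfolding cuts_ge_def
  proof (rule ballI, rule ccontr)
    fix X assume X: "X \<in> proper_sets (pverts G)" and lt: "\<not> k \<le> cut (parcs G) X"
    let ?F = "{e \<in> parcs G. fst e \<in> X \<and> snd e \<notin> X}"
    let ?H = "with_proj (G\<lparr>parcs := parcs G - ?F\<rparr>)"
    have sc: "strongly_connected ?H"
      using L lt unfolding k_edge_connected_def cut_def by force
    obtain u v where uv: "u \<in> X" "v \<in> pverts G" "v \<notin> X" "u \<in> pverts G"
      using X by (auto simp: proper_sets_def)
    with sc have "u \<rightarrow>\<^sup>*\<^bsub>?H\<^esub> v"
      unfolding strongly_connected_def by simp
    then have "(u, v) \<in> rtrancl_on (pverts G) (parcs G - ?F)"
      by (simp add: reachable_def)
    then have "v \<in> X"
      using uv(1) by (induction rule: rtrancl_on_induct) auto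
    with uv show False
      by simp
  qed
next
  interpret pair_fin_digraph G by fact
  assume R: "cuts_ge k (pverts G) (parcs G)"
  show "k_edge_connected k G"
    unfolding k_edge_connected_def
  proof (intro allI impI, elim conjE)
    fix F assume F: "F \<subseteq> parcs G" "card F < k"
    let ?H = "with_proj (G\<lparr>parcs := parcs G - F\<rparr>)"
    have "(u, v) \<in> rtrancl_on (pverts G) (parcs G - F)" if uv: "u \<in> pverts G" "v \<in> pverts G" for u v
    proof (rule ccontr)
      assume nr: "(u, v) \<notin> rtrancl_on (pverts G) (parcs G - F)"
      \<comment> \<open>Every edge leaving the set reachable from \<open>u\<close> without
        \<open>F\<close> must lie in \<open>F\<close>, so \<open>F\<close> would have at least
        \<open>k\<close> elements.\<close>
      let ?X = "{w \<in> pverts G. (u, w) \<in> rtrancl_on (pverts G) (parcs G - F)}"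
      have "u \<in> ?X"
        using uv by auto
      then have "?X \<in> proper_sets (pverts G)"
        using uv nr unfolding proper_sets_def by blast
      then have "k \<le> cut (parcs G) ?X"
        using R by (simp add: cuts_ge_def)
      also have "\<dots> \<le> card F"
        unfolding cut_def
      proof (rule card_mono)
        show "finite F"
          using F(1) pair_finite_arcs finite_subset by blast
        show "{e \<in> parcs G. fst e \<in> ?X \<and> snd e \<notin> ?X} \<subseteq> F"
        proof
          fix e assume e: "e \<in> {e \<in> parcs G. fst e \<in> ?X \<and> snd e \<notin> ?X}"
          then have "snd e \<in> pverts G"
            using arc_snd_in_verts by auto
          with e show "e \<in> F"
            using rtrancl_on_into_rtrancl_on[of u "fst e" "pverts G" "parcs G - F" "snd e"] by auto
        qed
      qed
      finally show False
        using F(2) by simp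
    qed
    then show "strongly_connected ?H"
      unfolding strongly_connected_def reachable_def using ne by simp
  qed
qed

text \<open>Without parallel edges, at most \<open>card V - 1\<close> edges lead from a vertex to
  other vertices; with \<open>2 \<le> card V\<close> its singleton is proper.\<close>

lemma not_cuts_ge_few_vertices:
  assumes fin: "finite V" and EV: "E \<subseteq> V \<times> V" and V: "2 \<le> card V" "card V \<le> k"
  shows "\<not> cuts_ge k V E"
proof
  assume cuts: "cuts_ge k V E"
  obtain v where v: "v \<in> V"
    using V by fastforce
  then have "{v} \<in> proper_sets V"
    using V by (auto simp: proper_sets_def)
  with cuts have "k \<le> cut E {v}"
    by (simp add: cuts_ge_def)
  also have "\<dots> \<le> card (Pair v ` (V - {v}))"
    unfolding cut_def using fin EV by (intro card_mono) auto
  also have "\<dots> = card V - 1"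
    using v fin by (simp add: card_image inj_on_def)
  finally show False
    using V by simp
qed

text \<open>With \<open>p\<close> the size of a largest packing over both orientations,
  \<open>augmentation\<close> reaches a k-edge connected graph by at most \<open>4 * p * k\<close>
  insertions, which must exceed the allowed number of modifications.\<close>

lemma far_imp_many_deficient_sets:
  assumes "pair_fin_digraph G" and k: "k < card (pverts G)"
    and far: "far_from_k_edge_connected \<epsilon> k G"
  shows "\<exists>D \<in> {parcs G, (parcs G)\<inverse>}. \<exists>F. F \<subseteq> deficient k (pverts G) D \<and> disjoint F \<and>
    \<epsilon> * real (card (parcs G)) < 4 * real k * real (card F)"
proof (rule ccontr)
  interpret pair_fin_digraph G by fact
  let ?V = "pverts G" and ?E = "parcs G"
  assume none: "\<not> ?thesis"
  define packings where "packings = {F. (F \<subseteq> deficient k ?V ?E \<or> F \<subseteq> deficient k ?V (?E\<inverse>)) \<and> disjoint F}"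
  have fin: "finite (deficient k ?V D)" for D
    using finite_proper_sets[OF pair_finite_verts] by (simp add: deficient_def)
  have "packings \<subseteq> Pow (deficient k ?V ?E) \<union> Pow (deficient k ?V (?E\<inverse>))"
    by (auto simp: packings_def)
  then have finP: "finite packings"
    by (rule finite_subset) (simp add: fin)
  have "{} \<in> packings"
    by (simp add: packings_def)
  then have neP: "card ` packings \<noteq> {}"
    by auto
  define p where "p = Max (card ` packings)"
  have p_max: "card F \<le> p" if "F \<in> packings" for F
    using finP that by (simp add: p_def)
  have "p \<in> card ` packings"
    unfolding p_def by (rule Max_in) (use finP neP in auto)
  then obtain F0 where "F0 \<in> packings" "card F0 = p"
    by auto
  with none have le: "4 * real k * real p \<le> \<epsilon> * real (card ?E)"
    unfolding packings_def by (auto simp: not_less)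
  have EV: "?E \<subseteq> ?V \<times> ?V"
    using wellformed' by auto
  have "packing_le p k ?V ?E" "packing_le p k ?V (?E\<inverse>)"
    using p_max by (auto simp: packing_le_def packings_def)
  from augmentation[OF pair_finite_verts EV k this]
  obtain E' where E': "?E \<subseteq> E'" "E' \<subseteq> ?V \<times> ?V" "card (E' - ?E) \<le> 4 * p * k" "cuts_ge k ?V E'"
    by blast
  let ?H = "\<lparr>pverts = ?V, parcs = E'\<rparr>"
  have ne: "?V \<noteq> {}"
    using k by auto
  have H: "pair_fin_digraph ?H"
    using E'(2) pair_finite_verts finite_edges[OF pair_finite_verts E'(2)] by unfold_locales auto
  have "k_edge_connected k ?H"
    using k_edge_connected_iff_cuts_ge[OF H, of k] ne E'(4) by simp
  with far H have "\<epsilon> * real (card ?V) * avg_degree G < real (card (sym_diff ?E E'))"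
    unfolding far_from_k_edge_connected_def by fastforce
  also have "sym_diff ?E E' = E' - ?E"
    using E'(1) by auto
  finally have "\<epsilon> * real (card ?E) < real (card (E' - ?E))"
    using ne pair_finite_verts by (simp add: avg_degree_def)
  also have "\<dots> \<le> real (4 * p * k)"
    using E'(3) by (rule of_nat_mono)
  finally show False
    using le by (simp add: algebra_simps)
qed

section \<open>Local search for a deficient set\<close>

lemma accept_prob_eq_pmf: "accept_prob orc A = pmf (map_pmf fst (run orc A)) True"
  unfolding accept_prob_def by (simp add: pmf_map vimage_def)

lemma reject_prob_eq: "reject_prob orc A = 1 - accept_prob orc A"
proof -
  have "{r. \<not> fst r} = UNIV - {r :: bool \<times> nat. fst r}"
    by auto
  then show ?thesis
    unfolding accept_prob_def reject_prob_def
    using measure_pmf.prob_compl[of "{r. fst r}" "run orc A"] by simp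
qed

lemma accept_prob_bounds: "0 \<le> accept_prob orc A" "accept_prob orc A \<le> 1"
  unfolding accept_prob_def by simp_all

lemma accept_prob_Halt [simp]: "accept_prob orc (Halt b) = of_bool b"
  by (simp add: accept_prob_eq_pmf)

lemma accept_prob_Ask [simp]: "accept_prob orc (Ask q f) = accept_prob orc (f (orc q))"
proof -
  have "map_pmf fst (run orc (Ask q f)) = map_pmf fst (run orc (f (orc q)))"
    by (simp add: pmf.map_comp o_def)
  then show ?thesis
    by (simp only: accept_prob_eq_pmf)
qed

lemma accept_prob_Draw:
  "accept_prob orc (Draw p f) = (\<integral>x. accept_prob orc (f x) \<partial>measure_pmf p)"
  by (simp add: accept_prob_eq_pmf map_bind_pmf pmf_bind)

lemma accept_prob_Draw_eq_1:
  assumes "\<And>x. x \<in> set_pmf p \<Longrightarrow> accept_prob orc (f x) = 1"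
  shows "accept_prob orc (Draw p f) = 1"
proof -
  have "accept_prob orc (Draw p f) = (\<integral>x. 1 \<partial>measure_pmf p)"
    unfolding accept_prob_Draw using assms by (intro integral_cong_AE) (auto simp: AE_measure_pmf_iff)
  then show ?thesis
    by simp
qed

definition queries_le :: "(edge_query \<Rightarrow> nat option) \<Rightarrow> nat \<Rightarrow> query_alg \<Rightarrow> bool" where
  "queries_le orc b A \<longleftrightarrow> (\<forall>r\<in>set_pmf (run orc A). snd r \<le> b)"

lemma queries_le_Halt [simp]: "queries_le orc b (Halt v)"
  by (simp add: queries_le_def)

lemma queries_le_Ask: "queries_le orc b (f (orc q)) \<Longrightarrow> queries_le orc (Suc b) (Ask q f)"
  by (auto simp: queries_le_def)

lemma queries_le_Draw:
  "(\<And>x. x \<in> set_pmf p \<Longrightarrow> queries_le orc b (f x)) \<Longrightarrow> queries_le orc b (Draw p f)"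
  by (auto simp: queries_le_def)

lemma queries_le_mono: "queries_le orc b A \<Longrightarrow> b \<le> b' \<Longrightarrow> queries_le orc b' A"
  unfolding queries_le_def by (meson le_trans)

text \<open>A rejection by either part is final, so one-sidedness is preserved; the draws are
  independent, so acceptance probabilities multiply.\<close>

primrec both :: "query_alg \<Rightarrow> query_alg \<Rightarrow> query_alg" where
  "both (Halt b) B = (if b then B else Halt False)"
| "both (Ask q f) B = Ask q (\<lambda>r. both (f r) B)"
| "both (Draw p f) B = Draw p (\<lambda>x. both (f x) B)"

lemma accept_prob_both: "accept_prob orc (both A B) = accept_prob orc A * accept_prob orc B"
  by (induction A) (simp_all add: accept_prob_Draw)

lemma queries_le_both:
  assumes "queries_le orc a A" "queries_le orc b B"
  shows "queries_le orc (a + b) (both A B)"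
  using assms(1)
proof (induction A arbitrary: a)
  case (Halt v)
  then show ?case
    using queries_le_mono[OF assms(2)] by simp
next
  case (Ask q f)
  \<comment> \<open>\<open>Ask\<close> spends a query on every run, so \<open>a\<close> cannot be
    0.\<close>
  then obtain a' where a': "a = Suc a'"
    using set_pmf_not_empty[of "run orc (f (orc q))"] by (cases a) (auto simp: queries_le_def)
  then have "queries_le orc a' (f (orc q))"
    using Ask.prems by (auto simp: queries_le_def)
  from queries_le_Ask[of orc _ "\<lambda>r. both (f r) B", OF Ask.IH[OF _ this]] show ?case
    by (simp add: a')
next
  case (Draw p f)
  have "queries_le orc (a + b) (both (f x) B)" if "x \<in> set_pmf p" for x
    by (rule Draw.IH) (use Draw.prems that in \<open>auto simp: queries_le_def\<close>)
  then show ?case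
    by (auto intro: queries_le_Draw)
qed

primrec repeat_alg :: "nat \<Rightarrow> query_alg \<Rightarrow> query_alg" where
  "repeat_alg 0 A = Halt True"
| "repeat_alg (Suc r) A = both A (repeat_alg r A)"

lemma accept_prob_repeat: "accept_prob orc (repeat_alg r A) = accept_prob orc A ^ r"
  by (induction r) (simp_all add: accept_prob_both)

lemma queries_le_repeat: "queries_le orc b A \<Longrightarrow> queries_le orc (r * b) (repeat_alg r A)"
  by (induction r) (simp_all add: queries_le_both)

section \<open>Reading incidence lists\<close>

primrec collect ::
  "(nat \<Rightarrow> edge_query) \<Rightarrow> nat \<Rightarrow> nat list \<Rightarrow> (nat list \<Rightarrow> query_alg) \<Rightarrow> query_alg" where
  "collect q 0 acc f = f acc"
| "collect q (Suc c) acc f =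
     Ask (q (length acc)) (\<lambda>r. case r of None \<Rightarrow> f acc | Some w \<Rightarrow> collect q c (acc @ [w]) f)"

text \<open>The accumulator is always a prefix \<open>take j L\<close>. Past the end of
  \<open>L\<close> the oracle answers \<open>None\<close> and \<open>take\<close> no longer changes,
  so stopping early passes on the same list.\<close>

lemma collect_take:
  assumes q: "\<And>i. orc (q i) = (if i < length L then Some (L ! i) else None)"
  shows "j \<le> length L \<Longrightarrow>
      accept_prob orc (collect q c (take j L) f) = accept_prob orc (f (take (j + c) L))"
    and "j \<le> length L \<Longrightarrow> queries_le orc b (f (take (j + c) L)) \<Longrightarrow>
      queries_le orc (b + c) (collect q c (take j L) f)"
proof (induction c arbitrary: j)
  case (Suc c)
  {
    case 1
    then show ?case
      using Suc.IH(1)[of "Suc j"] by (auto simp: q take_Suc_conv_app_nth[symmetric])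
  next
    case 2
    have "queries_le orc (b + c) (case orc (q (length (take j L))) of None \<Rightarrow> f (take j L)
        | Some w \<Rightarrow> collect q c (take j L @ [w]) f)"
    proof (cases "j < length L")
      case True
      then show ?thesis
        using Suc.IH(2)[of "Suc j"] 2 by (simp add: q take_Suc_conv_app_nth[symmetric])
    next
      case False
      then show ?thesis
        using 2 queries_le_mono[of orc b "f L" "b + c"] by (simp add: q)
    qed
    from queries_le_Ask[of orc _ "\<lambda>r. case r of None \<Rightarrow> f (take j L)
        | Some w \<Rightarrow> collect q c (take j L @ [w]) f", OF this] show ?case
      by simp
  }
qed simp_all

text \<open>Abstracts from the direction: \<open>Out_Edge\<close> explores the graph,
  \<open>In_Edge\<close> its reverse.\<close>

definition reads ::
  "(edge_query \<Rightarrow> nat option) \<Rightarrow> (nat \<Rightarrow> nat \<Rightarrow> edge_query) \<Rightarrow> (nat \<Rightarrow> nat list) \<Rightarrow> bool" where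
  "reads orc Q nb \<longleftrightarrow> (\<forall>u i. orc (Q u i) = (if i < length (nb u) then Some (nb u ! i) else None))"

lemma collect_reads:
  assumes "reads orc Q nb"
  shows "accept_prob orc (collect (Q u) c [] f) = accept_prob orc (f (take c (nb u)))"
    and "queries_le orc b (f (take c (nb u))) \<Longrightarrow> queries_le orc (b + c) (collect (Q u) c [] f)"
  using collect_take[where orc = orc and q = "Q u" and L = "nb u" and j = 0 and c = c] assms
  by (simp_all add: reads_def)

text \<open>
  \<open>K\<close> is the set of explored vertices and \<open>N u\<close> holds the first \<open>c\<close> out-neighbours of \<open>u \<in> K\<close>. A
  list of length \<open>c\<close> may be truncated; such a vertex gets weight \<open>k\<close>, so it lies in no set of weight
  less than \<open>k\<close>.
\<close>

definition known_cut :: "nat \<Rightarrow> nat \<Rightarrow> nat set \<Rightarrow> (nat \<Rightarrow> nat list) \<Rightarrow> nat set \<Rightarrow> nat" where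
  "known_cut k c K N Y = (\<Sum>u\<in>K \<inter> Y. if length (N u) < c then card (set (N u) - Y) else k)"

definition marks_outside :: "nat list \<Rightarrow> nat set \<Rightarrow> nat" where
  "marks_outside M Y = length (filter (\<lambda>y. y \<notin> Y) M)"

text \<open>The certificate for rejection. As \<open>Y\<close> is explored, weight below
  \<open>k\<close> means that no list in it is truncated and that its true cut is below
  \<open>k\<close>.\<close>

definition certified :: "nat \<Rightarrow> nat \<Rightarrow> nat \<Rightarrow> nat \<Rightarrow> nat set \<Rightarrow> (nat \<Rightarrow> nat list) \<Rightarrow> bool" where
  "certified n k c v K N \<longleftrightarrow> (\<exists>Y\<subseteq>K. v \<in> Y \<and> Y \<noteq> {..<n} \<and> known_cut k c K N Y < k)"

text \<open>
  Think of a flow sending one unit from \<open>v\<close> to each marked vertex. A set \<open>Y\<close> containing \<open>v\<close> with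
  equality below is saturated by that flow, and the frontier consists of the unexplored vertices
  that the residual graph still reaches from \<open>v\<close>.
\<close>

definition tight_sets ::
  "nat \<Rightarrow> nat \<Rightarrow> nat \<Rightarrow> nat \<Rightarrow> nat set \<Rightarrow> (nat \<Rightarrow> nat list) \<Rightarrow> nat list \<Rightarrow> nat set set" where
  "tight_sets n k c v K N M = {Y. v \<in> Y \<and> Y \<subseteq> {..<n} \<and> known_cut k c K N Y = marks_outside M Y}"

definition frontier ::
  "nat \<Rightarrow> nat \<Rightarrow> nat \<Rightarrow> nat \<Rightarrow> nat set \<Rightarrow> (nat \<Rightarrow> nat list) \<Rightarrow> nat list \<Rightarrow> nat set" where
  "frontier n k c v K N M = {u \<in> {..<n} - K. \<forall>Y\<in>tight_sets n k c v K N M. u \<in> Y}"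

text \<open>\<open>b\<close> bounds the number of vertices still to be explored. Exhausting it or
  the frontier leads to acceptance, since only a certificate justifies rejection.
  \<open>Draw\<close> yields natural numbers, so the marking coin is encoded as 0 or 1.\<close>

primrec search :: "(nat \<Rightarrow> nat \<Rightarrow> edge_query) \<Rightarrow> nat \<Rightarrow> nat \<Rightarrow> nat \<Rightarrow> real \<Rightarrow> nat \<Rightarrow> nat \<Rightarrow>
    nat set \<Rightarrow> (nat \<Rightarrow> nat list) \<Rightarrow> nat list \<Rightarrow> query_alg" where
  "search Q n k c p v 0 K N M = Halt True"
| "search Q n k c p v (Suc b) K N M =
     (if certified n k c v K N then Halt False
      else if frontier n k c v K N M = {} then Halt True
      else let u = LEAST u. u \<in> frontier n k c v K N M in
        collect (Q u) c [] (\<lambda>L. Draw (map_pmf of_bool (bernoulli_pmf p)) (\<lambda>x.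
          search Q n k c p v b (insert u K) (N(u := L)) (if x = 0 then M else u # M))))"

section \<open>Submodularity and tight sets in the explored graph\<close>

lemma marks_outside_modular:
  "marks_outside M (Y \<inter> Z) + marks_outside M (Y \<union> Z) = marks_outside M Y + marks_outside M Z"
  by (induction M) (auto simp: marks_outside_def)

lemma marks_outside_disjoint: "set M \<inter> X = {} \<Longrightarrow> marks_outside M X = length M"
  by (induction M) (auto simp: marks_outside_def)

text \<open>This holds for each vertex separately. A vertex in both sets contributes equally to the
  two sides; one in a single set is counted on the left only for the union, outside of which it has
  no more neighbours.\<close>

lemma known_cut_submodular:
  assumes "finite K"
  shows "known_cut k c K N (Y \<inter> Z) + known_cut k c K N (Y \<union> Z)
    \<le> known_cut k c K N Y + known_cut k c K N Z"
proof -
  let ?g = "\<lambda>Y u. if u \<in> Y then if length (N u) < c then card (set (N u) - Y) else k else 0"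
  have eq: "known_cut k c K N Y = (\<Sum>u\<in>K. ?g Y u)" for Y
    unfolding known_cut_def using assms by (rule sum.inter_restrict)
  have card_eq: "card (B - (Y \<inter> Z)) + card (B - (Y \<union> Z)) = card (B - Y) + card (B - Z)"
    if "finite B" for B :: "nat set"
    using card_Un_Int[of "B - Y" "B - Z"] that by (simp add: Diff_Int Diff_Un)
  have "?g (Y \<inter> Z) u + ?g (Y \<union> Z) u \<le> ?g Y u + ?g Z u" for u
    using card_eq[of "set (N u)"] by (auto intro: card_mono)
  then show ?thesis
    unfolding eq sum.distrib[symmetric] by (intro sum_mono) blast
qed

lemma known_cut_insert_ge:
  assumes "finite K" "u \<notin> K"
  shows "known_cut k c K N Y \<le> known_cut k c (insert u K) (N(u := L)) Y"
proof -
  have "known_cut k c K N Y = known_cut k c K (N(u := L)) Y"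
    unfolding known_cut_def using assms by (intro sum.cong) auto
  also have "\<dots> \<le> known_cut k c (insert u K) (N(u := L)) Y"
    unfolding known_cut_def using assms by (intro sum_mono2) auto
  finally show ?thesis .
qed

text \<open>\<open>known_cut\<close> minus \<open>marks_outside\<close> is submodular and, by
  \<open>inv\<close>, nonnegative on sets containing \<open>v\<close>. The tight sets are its zeros,
  hence closed under intersection.\<close>

lemma tight_sets_Int:
  assumes fin: "finite K"
    and inv: "\<And>Y. v \<in> Y \<Longrightarrow> Y \<subseteq> {..<n} \<Longrightarrow> marks_outside M Y \<le> known_cut k c K N Y"
    and Y: "Y \<in> tight_sets n k c v K N M" and Z: "Z \<in> tight_sets n k c v K N M"
  shows "Y \<inter> Z \<in> tight_sets n k c v K N M"
proof -
  have "v \<in> Y \<inter> Z" "Y \<inter> Z \<subseteq> {..<n}" "v \<in> Y \<union> Z" "Y \<union> Z \<subseteq> {..<n}"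
    using Y Z by (auto simp: tight_sets_def)
  with inv[of "Y \<inter> Z"] inv[of "Y \<union> Z"] known_cut_submodular[OF fin, of k c N Y Z]
    marks_outside_modular[of M Y Z] Y Z show ?thesis
    by (simp add: tight_sets_def)
qed

text \<open>If the frontier is empty, the least tight set is explored completely.\<close>

lemma frontier_nonempty:
  assumes K: "K \<subseteq> {..<n}"
    and inv: "\<And>Y. v \<in> Y \<Longrightarrow> Y \<subseteq> {..<n} \<Longrightarrow> marks_outside M Y \<le> known_cut k c K N Y"
    and X: "v \<in> X" "X \<subset> {..<n}" and M: "set M \<inter> X = {}" and lt: "known_cut k c K N X < k"
    and nc: "\<not> certified n k c v K N"
  shows "frontier n k c v K N M \<noteq> {}"
proof
  assume empty: "frontier n k c v K N M = {}"
  let ?T = "tight_sets n k c v K N M"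
  have finK: "finite K"
    by (rule finite_subset[OF K]) simp
  \<comment> \<open>All marks avoid \<open>X\<close>, so the invariant at \<open>X\<close> bounds
    their number by the known cut of \<open>X\<close>.\<close>
  have "marks_outside M X = length M"
    using M by (rule marks_outside_disjoint)
  with inv[of X] X lt have len: "length M < k"
    by auto
  have avoid: "\<exists>Y\<in>?T. u \<notin> Y" if "u \<in> {..<n} - K" for u
    using empty that by (auto simp: frontier_def)
  show False
  proof (cases "K = {..<n}")
    case True
    then have "certified n k c v K N"
      unfolding certified_def using X lt by (intro exI[of _ X]) auto
    with nc show False ..
  next
    case False
    have "finite ?T"
      by (rule finite_subset[of _ "Pow {..<n}"]) (auto simp: tight_sets_def)
    \<comment> \<open>Some vertex is unexplored, and the empty frontier provides a tight set
      avoiding it.\<close>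
    moreover have "?T \<noteq> {}"
      using avoid False K by blast
    ultimately obtain Y0 where Y0: "Y0 \<in> ?T" and min: "\<And>Z. Z \<in> ?T \<Longrightarrow> Z \<subseteq> Y0 \<Longrightarrow> Y0 = Z"
      using finite_has_minimal[of ?T] by auto
    have least: "Y0 \<subseteq> Z" if "Z \<in> ?T" for Z
      using min[OF tight_sets_Int[OF finK inv Y0 that]] by auto
    have "Y0 \<subseteq> K"
    proof
      fix u assume u: "u \<in> Y0"
      show "u \<in> K"
      proof (rule ccontr)
        assume "u \<notin> K"
        then have "u \<in> {..<n} - K"
          using u Y0 by (auto simp: tight_sets_def)
        with avoid least u show False
          by blast
      qed
    qed
    moreover have "known_cut k c K N Y0 < k"
    proof -
      have "known_cut k c K N Y0 = marks_outside M Y0"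
        using Y0 by (simp add: tight_sets_def)
      also have "\<dots> \<le> length M"
        by (simp add: marks_outside_def)
      finally show ?thesis
        using len by simp
    qed
    ultimately have "certified n k c v K N"
      unfolding certified_def using Y0 False K by (intro exI[of _ Y0]) (auto simp: tight_sets_def)
    with nc show False ..
  qed
qed

lemma search_step:
  assumes Q: "reads orc Q nb"
    and p: "0 \<le> p" "p \<le> 1"
    and nc: "\<not> certified n k c v K N" and fr: "frontier n k c v K N M \<noteq> {}"
  shows "\<exists>u\<in>frontier n k c v K N M. accept_prob orc (search Q n k c p v (Suc b) K N M) =
    p * accept_prob orc (search Q n k c p v b (insert u K) (N(u := take c (nb u))) (u # M)) +
    (1 - p) * accept_prob orc (search Q n k c p v b (insert u K) (N(u := take c (nb u))) M)"
proof -
  define u where "u = (LEAST u. u \<in> frontier n k c v K N M)"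
  have "u \<in> frontier n k c v K N M"
    unfolding u_def using fr by (meson LeastI ex_in_conv)
  moreover have "accept_prob orc (search Q n k c p v (Suc b) K N M) =
    p * accept_prob orc (search Q n k c p v b (insert u K) (N(u := take c (nb u))) (u # M)) +
    (1 - p) * accept_prob orc (search Q n k c p v b (insert u K) (N(u := take c (nb u))) M)"
    using nc fr p by (simp add: u_def[symmetric] collect_reads(1)[OF Q] accept_prob_Draw mult.commute)
  ultimately show ?thesis
    by blast
qed

lemma search_queries_le:
  assumes Q: "reads orc Q nb"
  shows "queries_le orc (b * c) (search Q n k c p v b K N M)"
proof (induction b arbitrary: K N M)
  case (Suc b)
  show ?case
    using Suc.IH collect_reads(2)[OF Q, of "b * c"] by (simp add: Let_def add.commute queries_le_Draw)
qed simp

lemma known_cut_not_truncated: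
  assumes "finite K" "\<And>u. u \<in> K \<Longrightarrow> N u = take c (nb u)" "Y \<subseteq> K" "known_cut k c K N Y < k"
  shows "known_cut k c K N Y = (\<Sum>u\<in>Y. card (set (nb u) - Y))"
proof -
  have KY: "K \<inter> Y = Y" and finY: "finite Y"
    using assms finite_subset by auto
  let ?g = "\<lambda>u. if length (N u) < c then card (set (N u) - Y) else k"
  have "N u = nb u" "length (N u) < c" if u: "u \<in> Y" for u
  proof -
    have "?g u \<le> known_cut k c K N Y"
      unfolding known_cut_def KY using finY u by (intro member_le_sum) auto
    then show len: "length (N u) < c"
      using assms(4) by (auto split: if_splits)
    show "N u = nb u"
      using len assms(2)[of u] assms(3) u by auto
  qed
  then show ?thesis
    unfolding known_cut_def KY by (intro sum.cong) auto
qed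

text \<open>The search rejects only with a certificate, and by
  \<open>known_cut_not_truncated\<close> a certificate is a proper set violating
  \<open>cuts\<close>.\<close>

lemma search_accepts:
  assumes Q: "reads orc Q nb"
    and p: "0 \<le> p" "p \<le> 1"
    and cuts: "\<And>Y. Y \<in> proper_sets {..<n} \<Longrightarrow> k \<le> (\<Sum>u\<in>Y. card (set (nb u) - Y))"
  shows "K \<subseteq> {..<n} \<Longrightarrow> (\<And>u. u \<in> K \<Longrightarrow> N u = take c (nb u)) \<Longrightarrow>
    accept_prob orc (search Q n k c p v b K N M) = 1"
proof (induction b arbitrary: K N M)
  case (Suc b)
  have finK: "finite K"
    by (rule finite_subset[OF Suc.prems(1)]) simp
  have nc: "\<not> certified n k c v K N"
  proof
    assume "certified n k c v K N"
    then obtain Y where Y: "Y \<subseteq> K" "v \<in> Y" "Y \<noteq> {..<n}" "known_cut k c K N Y < k"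
      by (auto simp: certified_def)
    then have "Y \<in> proper_sets {..<n}"
      using Suc.prems(1) by (auto simp: proper_sets_def)
    with cuts known_cut_not_truncated[OF finK Suc.prems(2) Y(1,4)] Y(4) show False
      by fastforce
  qed
  show ?case
  proof (cases "frontier n k c v K N M = {}")
    case True
    with nc show ?thesis
      by simp
  next
    case False
    obtain u where u: "u \<in> frontier n k c v K N M"
      and step: "accept_prob orc (search Q n k c p v (Suc b) K N M) =
        p * accept_prob orc (search Q n k c p v b (insert u K) (N(u := take c (nb u))) (u # M)) +
        (1 - p) * accept_prob orc (search Q n k c p v b (insert u K) (N(u := take c (nb u))) M)"
      using search_step[where b = b, OF Q p nc False] by blast
    have "insert u K \<subseteq> {..<n}"
      using u Suc.prems(1) by (auto simp: frontier_def)
    moreover have "(N(u := take c (nb u))) w = take c (nb w)" if "w \<in> insert u K" for w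
      using that Suc.prems(2) by auto
    ultimately have "accept_prob orc (search Q n k c p v b (insert u K) (N(u := take c (nb u))) M') = 1"
      for M'
      by (rule Suc.IH)
    with step show ?thesis
      by simp
  qed
qed simp

text \<open>
  \<open>X\<close> can only be missed if some vertex of \<open>X\<close> gets marked, or if too few of the explored vertices
  outside \<open>X\<close> get marked: once there are as many marks outside \<open>X\<close> as edges leaving \<open>X\<close>, the set \<open>X\<close>
  is tight and only vertices of \<open>X\<close> are explored. The second summand is a supermartingale that
  bounds the probability of fewer than \<open>d - length M\<close> successes in \<open>t\<close> trials.
\<close>

lemma search_accept_prob_le:
  assumes Q: "reads orc Q nb"
    and p: "0 \<le> p" "p \<le> 1"
    and X: "v \<in> X" "X \<subset> {..<n}"
    and d: "(\<Sum>u\<in>X. card (set (nb u) - X)) = d" "d < k"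
    and deg: "\<And>u. u \<in> X \<Longrightarrow> length (nb u) < c"
  shows "K \<subseteq> {..<n} \<Longrightarrow> (\<And>u. u \<in> K \<Longrightarrow> N u = take c (nb u)) \<Longrightarrow>
    (\<And>Y. v \<in> Y \<Longrightarrow> Y \<subseteq> {..<n} \<Longrightarrow> marks_outside M Y \<le> known_cut k c K N Y) \<Longrightarrow>
    set M \<inter> X = {} \<Longrightarrow> t + card (X - K) \<le> b \<Longrightarrow>
    accept_prob orc (search Q n k c p v b K N M)
      \<le> real (card (X - K)) * p + 2 ^ (d - length M) * (1 - p / 2) ^ t"
proof (induction b arbitrary: K N M t)
  case 0
  \<comment> \<open>With budget 0, both \<open>t\<close> and \<open>card (X - K)\<close> are 0, and
    the bound is at least 1.\<close>
  have "1 \<le> real (card (X - K)) * p + 2 ^ (d - length M) * (1 - p / 2) ^ t"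
    using 0 by simp
  then show ?case
    using accept_prob_bounds(2) order_trans by blast
next
  case (Suc b)
  let ?acc = "\<lambda>b K N M. accept_prob orc (search Q n k c p v b K N M)"
  have finX: "finite X"
    by (rule finite_subset[of _ "{..<n}"]) (use X in auto)
  have finK: "finite K"
    by (rule finite_subset[OF Suc.prems(1)]) simp
  have cutX: "known_cut k c K N X \<le> d"
  proof -
    have "known_cut k c K N X = (\<Sum>u\<in>K \<inter> X. card (set (nb u) - X))"
      unfolding known_cut_def using Suc.prems(2) deg by (intro sum.cong) (simp_all add: less_imp_le)
    also have "\<dots> \<le> d"
      unfolding d(1)[symmetric] using finX by (intro sum_mono2) auto
    finally show ?thesis .
  qed
  have outM: "marks_outside M X = length M"
    using Suc.prems(4) by (rule marks_outside_disjoint)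
  have p2: "0 \<le> 1 - p / 2" "1 - p / 2 \<le> 1"
    using p by auto
  show ?case
  proof (cases "certified n k c v K N")
    case True
    then show ?thesis
      using p p2 by simp
  next
    case nc: False
    show ?thesis
    proof (cases t)
      case 0
      have "1 \<le> (2 :: real) ^ (d - length M)"
        by simp
      then have "1 \<le> real (card (X - K)) * p + 2 ^ (d - length M) * (1 - p / 2) ^ t"
        using p unfolding 0 by (simp add: add_increasing)
      then show ?thesis
        using accept_prob_bounds(2) order_trans by blast
    next
      case (Suc t')
      have "frontier n k c v K N M \<noteq> {}"
        using frontier_nonempty[OF Suc.prems(1,3) X Suc.prems(4) _ nc] cutX d(2) by linarith
      from search_step[where b = b, OF Q p nc this]
      obtain u where u: "u \<in> frontier n k c v K N M" and
        step: "?acc (Suc b) K N M = p * ?acc b (insert u K) (N(u := take c (nb u))) (u # M)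
          + (1 - p) * ?acc b (insert u K) (N(u := take c (nb u))) M"
        by blast
      define K' N' where "K' = insert u K" and "N' = N(u := take c (nb u))"
      have uK: "u < n" "u \<notin> K"
        using u by (auto simp: frontier_def)
      have K': "K' \<subseteq> {..<n}"
        using uK Suc.prems(1) by (auto simp: K'_def)
      have N': "N' w = take c (nb w)" if "w \<in> K'" for w
        using that Suc.prems(2) by (auto simp: K'_def N'_def)
      have mono: "known_cut k c K N Y \<le> known_cut k c K' N' Y" for Y
        unfolding K'_def N'_def by (rule known_cut_insert_ge[OF finK uK(2)])
      have inv: "marks_outside M Y \<le> known_cut k c K' N' Y" if "v \<in> Y" "Y \<subseteq> {..<n}" for Y
        using Suc.prems(3)[OF that] mono[of Y] by linarith
      show ?thesis
      proof (cases "u \<in> X")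
        case True
        \<comment> \<open>If \<open>u\<close> is marked, the trivial bound 1 is used. This costs
          \<open>p\<close>, which is paid by the decrease of \<open>card (X - K)\<close>, while
          \<open>t\<close> is kept.\<close>
        have "X - K' = (X - K) - {u}"
          by (auto simp: K'_def)
        then have card_eq: "card (X - K) = Suc (card (X - K'))"
          using card_Suc_Diff1[of "X - K" u] True uK(2) finX by simp
        have IH: "?acc b K' N' M \<le> real (card (X - K')) * p + 2 ^ (d - length M) * (1 - p / 2) ^ t"
          using Suc.prems(4,5) card_eq by (intro Suc.IH K' N' inv) auto
        have "?acc (Suc b) K N M \<le> p * 1 + (1 - p) * ?acc b K' N' M"
          unfolding step K'_def[symmetric] N'_def[symmetric]
          using p accept_prob_bounds(2) by (intro add_mono mult_left_mono) auto
        also have "\<dots> \<le> p + 1 * ?acc b K' N' M"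
          using p accept_prob_bounds(1) by (intro add_mono mult_right_mono) auto
        also have "\<dots> \<le> real (card (X - K)) * p + 2 ^ (d - length M) * (1 - p / 2) ^ t"
          using IH by (simp add: card_eq algebra_simps)
        finally show ?thesis .
      next
        case False
        have XK: "X - K' = X - K"
          using False by (auto simp: K'_def)
        \<comment> \<open>\<open>u\<close> belongs to every tight set, so \<open>X\<close> is not
          tight and still lacks a mark.\<close>
        have "X \<notin> tight_sets n k c v K N M"
          using u False by (auto simp: frontier_def)
        then have "length M < known_cut k c K N X"
          using Suc.prems(3)[of X] X outM by (auto simp: tight_sets_def)
        then have lenM: "length M < d"
          using cutX by simp
        \<comment> \<open>The new mark raises \<open>marks_outside\<close> only for sets avoiding
          \<open>u\<close>. These are not tight, so the invariant leaves room for it.\<close>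
        have inv': "marks_outside (u # M) Y \<le> known_cut k c K' N' Y" if Y: "v \<in> Y" "Y \<subseteq> {..<n}" for Y
        proof (cases "u \<in> Y")
          case True
          then show ?thesis
            using inv[OF Y] by (simp add: marks_outside_def)
        next
          case False
          then have "Y \<notin> tight_sets n k c v K N M"
            using u by (auto simp: frontier_def)
          then have "marks_outside M Y < known_cut k c K N Y"
            using Suc.prems(3)[OF Y] Y by (auto simp: tight_sets_def)
          then show ?thesis
            using mono[of Y] False by (simp add: marks_outside_def)
        qed
        let ?r = "real (card (X - K)) * p" and ?w = "(1 - p / 2) ^ t'"
        have marked: "?acc b K' N' (u # M) \<le> ?r + 2 ^ (d - length (u # M)) * ?w"
          unfolding XK[symmetric] using Suc.prems(4,5) False XK \<open>t = Suc t'\<close>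
          by (intro Suc.IH K' N' inv') auto
        have unmarked: "?acc b K' N' M \<le> ?r + 2 ^ (d - length M) * ?w"
          unfolding XK[symmetric] using Suc.prems(4,5) XK \<open>t = Suc t'\<close>
          by (intro Suc.IH K' N' inv) auto
        obtain e where e: "d - length M = Suc e"
          using lenM by (metis Suc_diff_Suc)
        then have e': "d - length (u # M) = e"
          by simp
        \<comment> \<open>A mark halves the power of 2, and
          \<open>p / 2 + (1 - p) = 1 - p / 2\<close> is the factor between \<open>t'\<close> and
          \<open>t\<close>.\<close>
        have "?acc (Suc b) K N M \<le> p * (?r + 2 ^ e * ?w) + (1 - p) * (?r + 2 ^ Suc e * ?w)"
          unfolding step K'_def[symmetric] N'_def[symmetric]
          using p marked unmarked unfolding e e' by (intro add_mono mult_left_mono) auto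
        also have "\<dots> = ?r + 2 ^ (d - length M) * (1 - p / 2) ^ t"
          unfolding e \<open>t = Suc t'\<close> by (simp add: algebra_simps)
        finally show ?thesis .
      qed
    qed
  qed
qed

section \<open>The tester\<close>

lemma deficientD:
  assumes "X \<in> deficient k V E"
  shows "X \<subset> V" "X \<noteq> {}" "cut E X < k" "finite V \<Longrightarrow> finite X"
  using assms by (auto simp: deficient_def proper_sets_def intro: finite_subset)

lemma cut_eq_sum:
  assumes "finite X" and nb: "\<And>u. set (nb u) = {w. (u, w) \<in> E}"
  shows "cut E X = (\<Sum>u\<in>X. card (set (nb u) - X))"
proof -
  have "{e \<in> E. fst e \<in> X \<and> snd e \<notin> X} = Sigma X (\<lambda>u. set (nb u) - X)"
    by (auto simp: nb)
  then show ?thesis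
    unfolding cut_def using assms(1) by simp
qed

text \<open>
  A vertex outside the sought set is marked with probability \<open>1 / (4 s)\<close>, so \<open>8 s (k + 2)\<close> of them
  yield fewer than \<open>k\<close> marks with probability at most 1/4; at most \<open>s\<close> vertices lie inside.
\<close>

definition search_size :: "nat \<Rightarrow> nat \<Rightarrow> nat" where
  "search_size k s = 8 * s * (k + 2) + s"

definition local_test :: "(nat \<Rightarrow> nat \<Rightarrow> edge_query) \<Rightarrow> nat \<Rightarrow> nat \<Rightarrow> nat \<Rightarrow> nat \<Rightarrow> query_alg" where
  "local_test Q n k s v =
     search Q n k (s + k) (1 / (4 * real s)) v (search_size k s) {} (\<lambda>_. []) []"

text \<open>Each block of \<open>8 * s\<close> trials contributes a factor at most
  \<open>exp (- 1) \<le> 1 / 2\<close>. Of the \<open>k + 2\<close> factors, \<open>k\<close> absorb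
  \<open>2 ^ d\<close> and two remain.\<close>

lemma miss_prob_le:
  assumes s: "0 < s" and d: "d \<le> k"
  shows "2 ^ d * (1 - 1 / (4 * real s) / 2) ^ (8 * s * (k + 2)) \<le> (1 / 4 :: real)"
proof -
  have s1: "1 \<le> real s"
    using s by simp
  then have base: "0 \<le> 1 - 1 / (4 * real s) / 2"
    by (simp add: field_simps)
  have "(1 - 1 / (4 * real s) / 2) ^ (8 * s) \<le> exp (- (1 / (4 * real s) / 2)) ^ (8 * s)"
    using exp_ge_add_one_self[of "- (1 / (4 * real s) / 2)"] base by (intro power_mono) auto
  also have "\<dots> = exp (- 1)"
    using s1 by (simp add: exp_of_nat_mult[symmetric] field_simps)
  also have "\<dots> \<le> 1 / 2"
    using exp_ge_add_one_self[of 1] by (simp add: exp_minus field_simps)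
  finally have half: "(1 - 1 / (4 * real s) / 2) ^ (8 * s) \<le> 1 / 2" .
  have "(1 - 1 / (4 * real s) / 2) ^ (8 * s * (k + 2)) = ((1 - 1 / (4 * real s) / 2) ^ (8 * s)) ^ (k + 2)"
    by (rule power_mult)
  also have "\<dots> \<le> (1 / 2) ^ (k + 2)"
    using half base by (intro power_mono) auto
  finally have "2 ^ d * (1 - 1 / (4 * real s) / 2) ^ (8 * s * (k + 2)) \<le> 2 ^ k * (1 / 2) ^ (k + 2)"
    using d base by (intro mult_mono power_increasing) auto
  also have "\<dots> = 1 / 4"
    by (simp add: power_add power_one_over)
  finally show ?thesis .
qed

text \<open>Each of the two ways of missing \<open>X\<close> accounts for at most 1/4: a mark on one
  of its at most \<open>s\<close> vertices, or too few marks outside.\<close>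

lemma local_test_finds:
  assumes Q: "reads orc Q nb"
    and nb: "\<And>u. distinct (nb u)" "\<And>u. set (nb u) = {w. (u, w) \<in> E}"
    and X: "X \<in> deficient k {..<n} E" "v \<in> X" "card X \<le> s"
  shows "accept_prob orc (local_test Q n k s v) \<le> 1 / 2"
proof -
  note XV = deficientD(1)[OF X(1)] and lt = deficientD(3)[OF X(1)]
  have finX: "finite X"
    using deficientD(4)[OF X(1)] by simp
  have "0 < card X"
    using finX X(2) by (auto simp: card_gt_0_iff)
  with X(3) have s: "0 < s"
    by simp
  define d where "d = (\<Sum>u\<in>X. card (set (nb u) - X))"
  have d_cut: "d = cut E X"
    unfolding d_def by (rule cut_eq_sum[OF finX nb(2), symmetric])
  \<comment> \<open>Without parallel edges, \<open>u\<close> has at most \<open>s\<close> neighbours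
    in \<open>X\<close> and fewer than \<open>k\<close> outside, so no list in \<open>X\<close>
    reaches the truncation length.\<close>
  have deg: "length (nb u) < s + k" if u: "u \<in> X" for u
  proof -
    have "length (nb u) = card (set (nb u))"
      using nb(1) by (simp add: distinct_card)
    also have "\<dots> \<le> card (X \<union> (set (nb u) - X))"
      using finX by (intro card_mono) auto
    also have "\<dots> \<le> card X + card (set (nb u) - X)"
      by (rule card_Un_le)
    also have "card (set (nb u) - X) \<le> d"
      unfolding d_def using finX u by (intro member_le_sum) auto
    finally show ?thesis
      using X(3) lt d_cut by linarith
  qed
  have p: "0 \<le> 1 / (4 * real s)" "1 / (4 * real s) \<le> 1"
    using s by (auto simp: field_simps)
  have "accept_prob orc (local_test Q n k s v)
      \<le> real (card (X - {})) * (1 / (4 * real s))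
        + 2 ^ (d - length ([] :: nat list)) * (1 - 1 / (4 * real s) / 2) ^ (8 * s * (k + 2))"
    unfolding local_test_def
  proof (rule search_accept_prob_le[OF Q p X(2) XV d_def[symmetric]])
    show "d < k"
      using lt d_cut by simp
    show "8 * s * (k + 2) + card (X - {}) \<le> search_size k s"
      using X(3) by (simp add: search_size_def)
  qed (use deg in \<open>auto simp: marks_outside_def known_cut_def\<close>)
  also have "\<dots> \<le> 1 / 4 + 1 / 4"
  proof (rule add_mono)
    show "real (card (X - {})) * (1 / (4 * real s)) \<le> 1 / 4"
      using X(3) s by (simp add: field_simps)
    show "2 ^ (d - length ([] :: nat list)) * (1 - 1 / (4 * real s) / 2) ^ (8 * s * (k + 2)) \<le> (1 / 4 :: real)"
      using miss_prob_le[OF s, of d k] lt d_cut by simp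
  qed
  finally show ?thesis
    by simp
qed

lemma local_test_accepts:
  assumes Q: "reads orc Q nb"
    and nb: "\<And>u. set (nb u) = {w. (u, w) \<in> E}"
    and s: "0 < s" and cuts: "cuts_ge k {..<n} E"
  shows "accept_prob orc (local_test Q n k s v) = 1"
  unfolding local_test_def
proof (rule search_accepts[OF Q])
  show "0 \<le> 1 / (4 * real s)" "1 / (4 * real s) \<le> 1"
    using s by (auto simp: field_simps)
  fix Y assume Y: "Y \<in> proper_sets {..<n}"
  then have "finite Y"
    using finite_subset[of Y "{..<n}"] by (simp add: proper_sets_def)
  from cut_eq_sum[OF this nb] have "(\<Sum>u\<in>Y. card (set (nb u) - Y)) = cut E Y"
    by simp
  then show "k \<le> (\<Sum>u\<in>Y. card (set (nb u) - Y))"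
    using cuts Y by (simp add: cuts_ge_def)
qed auto

lemma local_test_queries_le:
  assumes "reads orc Q nb"
  shows "queries_le orc (search_size k s * (s + k)) (local_test Q n k s v)"
  unfolding local_test_def by (rule search_queries_le[OF assms])

text \<open>A far graph is guaranteed many disjoint deficient sets in one orientation only, and it
  is unknown which, so every sample is searched in both.\<close>

definition test_round :: "nat \<Rightarrow> nat \<Rightarrow> nat \<Rightarrow> query_alg" where
  "test_round n k s = Draw (pmf_of_set {..<n})
     (\<lambda>v. both (local_test Out_Edge n k s v) (local_test In_Edge n k s v))"

section \<open>Counting in disjoint families, and the rejection probability of a round\<close>

lemma sum_card_disjoint_le:
  assumes "finite V" "disjoint F" "\<And>X. X \<in> F \<Longrightarrow> X \<subseteq> V"
  shows "(\<Sum>X\<in>F. card X) = card (\<Union>F)" "card (\<Union>F) \<le> card V"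
proof -
  have finX: "finite X" if "X \<in> F" for X
    using assms(1) assms(3)[OF that] by (rule finite_subset[rotated])
  show "(\<Sum>X\<in>F. card X) = card (\<Union>F)"
    using assms(2) finX by (intro card_Union_disjoint[symmetric]) (auto simp: disjoint_def pairwise_def disjnt_def)
  show "card (\<Union>F) \<le> card V"
    using assms by (intro card_mono) auto
qed

lemma card_packing_le:
  assumes fin: "finite V" and F: "F \<subseteq> deficient k V E" "disjoint F"
  shows "card F \<le> card V"
proof -
  have sub: "X \<subseteq> V" if "X \<in> F" for X
    using F(1) that deficientD(1) by blast
  have "1 \<le> card X" if "X \<in> F" for X
    using subsetD[OF F(1) that] deficientD(2,4)[of X k V E] fin by (simp add: Suc_le_eq card_gt_0_iff)
  then have "(\<Sum>X\<in>F. 1) \<le> (\<Sum>X\<in>F. card X)"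
    by (intro sum_mono)
  also have "\<dots> \<le> card V"
    using sum_card_disjoint_le[OF fin F(2) sub] by simp
  finally show ?thesis
    by simp
qed

text \<open>Fewer than \<open>card V / s\<close> disjoint sets have more than \<open>s\<close> elements.\<close>

lemma card_small_packing:
  assumes fin: "finite V" and F: "F \<subseteq> deficient k V E" "disjoint F" and s: "0 < s"
    and q: "q < real (card F)" "2 * real (card V) \<le> q * real s"
  shows "q / 2 \<le> real (card (\<Union>{X \<in> F. card X \<le> s}))"
proof -
  let ?S = "{X \<in> F. card X \<le> s}" and ?B = "{X \<in> F. s < card X}"
  have sub: "X \<subseteq> V" if "X \<in> F" for X
    using F(1) that deficientD(1) by blast
  then have finF: "finite F"
    using finite_subset[of F "Pow V"] fin by auto
  have dis: "disjoint ?S" "disjoint ?B"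
    using F(2) by (auto simp: disjoint_def)
  have "s * card ?B = (\<Sum>X\<in>?B. s)"
    by simp
  also have "\<dots> \<le> (\<Sum>X\<in>?B. card X)"
    by (intro sum_mono) auto
  also have "\<dots> \<le> card V"
    using sum_card_disjoint_le[OF fin dis(2)] sub by auto
  finally have "real s * real (card ?B) \<le> real (card V)"
    by (simp only: of_nat_mult[symmetric] of_nat_le_iff)
  with q(2) have "real s * (2 * real (card ?B)) \<le> real s * q"
    by (simp add: mult.commute)
  then have B: "2 * real (card ?B) \<le> q"
    using s by simp
  \<comment> \<open>There are more than \<open>q\<close> sets, at most \<open>q / 2\<close> of them
    large; each remaining one is nonempty and contributes a vertex of its own.\<close>
  have "F = ?S \<union> ?B" "?S \<inter> ?B = {}"
    by auto
  then have "card F = card ?S + card ?B"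
    using finF by (metis card_Un_disjoint finite_Un)
  moreover have "card ?S \<le> (\<Sum>X\<in>?S. card X)"
  proof -
    have "1 \<le> card X" if "X \<in> ?S" for X
      using subsetD[OF F(1), of X] that deficientD(2,4)[of X k V E] fin
      by (simp add: Suc_le_eq card_gt_0_iff)
    then have "(\<Sum>X\<in>?S. 1) \<le> (\<Sum>X\<in>?S. card X)"
      by (intro sum_mono)
    then show ?thesis
      by simp
  qed
  moreover have "(\<Sum>X\<in>?S. card X) = card (\<Union>?S)"
    using sum_card_disjoint_le(1)[OF fin dis(1)] sub by auto
  ultimately show ?thesis
    using B q(1) by linarith
qed

lemma test_round_accept_prob_le:
  assumes n: "0 < n" and U: "U \<subseteq> {..<n}"
    and half: "\<And>v. v \<in> U \<Longrightarrow> accept_prob orc (local_test Out_Edge n k s v) \<le> 1 / 2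
      \<or> accept_prob orc (local_test In_Edge n k s v) \<le> 1 / 2"
  shows "accept_prob orc (test_round n k s) \<le> 1 - real (card U) / (2 * real n)"
proof -
  let ?A = "\<lambda>v. accept_prob orc (local_test Out_Edge n k s v) * accept_prob orc (local_test In_Edge n k s v)"
  have le: "?A v \<le> 1 - of_bool (v \<in> U) / 2" for v
  proof (cases "v \<in> U")
    case True
    have "?A v \<le> accept_prob orc (local_test Out_Edge n k s v)"
      "?A v \<le> accept_prob orc (local_test In_Edge n k s v)"
      by (simp_all add: mult_left_le mult_left_le_one_le accept_prob_bounds)
    then show ?thesis
      using half[OF True] True by auto
  next
    case False
    then show ?thesis
      by (simp add: mult_le_one accept_prob_bounds)
  qed
  have "accept_prob orc (test_round n k s) = (\<Sum>v<n. ?A v) / real n"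
    unfolding test_round_def accept_prob_Draw accept_prob_both
    using n by (subst integral_pmf_of_set) auto
  also have "(\<Sum>v<n. ?A v) \<le> (\<Sum>v<n. 1 - of_bool (v \<in> U) / 2)"
    by (intro sum_mono le)
  also have "\<dots> = real n - real (card U) / 2"
  proof -
    have "{..<n} \<inter> U = U"
      using U by auto
    then show ?thesis
      by (simp add: sum_subtractf sum_divide_distrib[symmetric] of_bool_def sum.If_cases Int_def[symmetric])
  qed
  finally show ?thesis
    using n by (simp add: field_simps)
qed

text \<open>
  For \<open>2 \<le> n \<le> k\<close> no graph without parallel edges is k-edge connected. With \<open>q\<close> denoting
  \<open>\<epsilon> m / (4 k)\<close>, a far graph has more than \<open>q\<close> disjoint deficient sets, and \<open>l = n / q\<close>; hence no graph
  is far if \<open>l \<le> 1\<close>.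
\<close>

definition tester :: "nat \<Rightarrow> nat \<Rightarrow> real \<Rightarrow> nat \<Rightarrow> query_alg" where
  "tester n m \<epsilon> k =
     (let l = 4 * real k * real n / (\<epsilon> * real m) in
      if n = 1 then Halt True else if n \<le> k then Halt False else if l \<le> 1 then Halt True
      else repeat_alg (nat \<lceil>8 * l\<rceil>) (test_round n k (nat \<lceil>2 * l\<rceil>)))"

section \<open>Correctness and query bound of the tester\<close>

lemma tester_accepts:
  assumes G: "graph_input n m G orc" and n: "1 \<le> n" and kec: "k_edge_connected k G"
  shows "accept_prob orc (tester n m \<epsilon> k) = 1"
proof -
  interpret pair_fin_digraph G
    using G by (simp add: graph_input_def)
  have V: "pverts G = {..<n}"
    using G by (simp add: graph_input_def)
  obtain outs ins where inc: "incidence_lists G outs ins" and orc: "orc = answer outs ins"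
    using G by (auto simp: graph_input_def)
  have reads: "reads orc Out_Edge outs" "reads orc In_Edge ins"
    by (simp_all add: orc reads_def)
  have EV: "parcs G \<subseteq> {..<n} \<times> {..<n}"
    using wellformed' V by auto
  have cuts: "cuts_ge k {..<n} (parcs G)"
    using kec k_edge_connected_iff_cuts_ge[of G k] V n by (auto simp: lessThan_empty_iff pair_fin_digraph_axioms)
  have "\<not> (n \<noteq> 1 \<and> n \<le> k)"
    using not_cuts_ge_few_vertices[OF _ EV, of k] cuts n by auto
  moreover have "accept_prob orc (test_round n k s) = 1" if "0 < s" for s
    unfolding test_round_def
  proof (rule accept_prob_Draw_eq_1)
    fix v
    have "accept_prob orc (local_test Out_Edge n k s v) = 1"
      using inc by (intro local_test_accepts[OF reads(1) _ that cuts]) (simp add: incidence_lists_def)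
    moreover have "accept_prob orc (local_test In_Edge n k s v) = 1"
      using inc by (intro local_test_accepts[OF reads(2) _ that cuts_ge_converse[OF EV cuts]])
        (simp add: incidence_lists_def)
    ultimately show "accept_prob orc (both (local_test Out_Edge n k s v) (local_test In_Edge n k s v)) = 1"
      by (simp add: accept_prob_both)
  qed
  ultimately show ?thesis
    by (auto simp: tester_def Let_def accept_prob_repeat)
qed

lemma tester_accept_prob_le:
  assumes G: "graph_input n m G orc" and nm: "1 \<le> n" "1 \<le> m" and eps: "0 < \<epsilon>" and k: "1 \<le> k"
    and far: "far_from_k_edge_connected \<epsilon> k G"
  shows "accept_prob orc (tester n m \<epsilon> k) \<le> 1 / 3"
proof -
  interpret pair_fin_digraph G
    using G by (simp add: graph_input_def)
  have fd: "pair_fin_digraph G"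
    by unfold_locales
  have V: "pverts G = {..<n}" and m: "card (parcs G) = m"
    using G by (simp_all add: graph_input_def)
  obtain outs ins where inc: "incidence_lists G outs ins" and orc: "orc = answer outs ins"
    using G by (auto simp: graph_input_def)
  have reads: "reads orc Out_Edge outs" "reads orc In_Edge ins"
    by (simp_all add: orc reads_def)
  define l where "l = 4 * real k * real n / (\<epsilon> * real m)"
  \<comment> \<open>A single vertex has no proper set, so \<open>G\<close> itself is k-edge
    connected, at distance 0, and cannot be far.\<close>
  have n1: "n \<noteq> 1"
  proof
    assume n: "n = 1"
    have "proper_sets (pverts G) = {}"
      by (auto simp: V n proper_sets_def lessThan_Suc)
    then have "k_edge_connected k G"
      using k_edge_connected_iff_cuts_ge[OF fd, of k] V n by (auto simp: cuts_ge_def)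
    with far fd have "\<epsilon> * real (card (pverts G)) * avg_degree G < 0"
      unfolding far_from_k_edge_connected_def by fastforce
    then show False
      using eps by (auto simp: avg_degree_def mult_less_0_iff split: if_splits)
  qed
  show ?thesis
  proof (cases "n \<le> k")
    case True
    then show ?thesis
      using n1 by (simp add: tester_def Let_def)
  next
    case False
    then have "k < card (pverts G)"
      by (simp add: V)
    from far_imp_many_deficient_sets[OF fd this far]
    obtain E F where E: "E = parcs G \<or> E = (parcs G)\<inverse>" and F: "F \<subseteq> deficient k {..<n} E" "disjoint F"
      and big: "\<epsilon> * real m < 4 * real k * real (card F)"
      unfolding V m by blast
    have pos: "0 < \<epsilon> * real m" "0 < real k" "0 < real n"
      using eps nm k by auto
    have lpos: "0 < l"
      unfolding l_def using pos by simp
    have big': "real n / l < real (card F)"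
      using big pos by (simp add: l_def field_simps)
    \<comment> \<open>A packing has at most \<open>n\<close> members, which rules out the accepting
      branch \<open>l \<le> 1\<close>.\<close>
    have "real (card F) \<le> real n"
      using card_packing_le[OF _ F] by simp
    with big' have "real n / l < real n"
      by linarith
    then have "real n * 1 < real n * l"
      using lpos by (simp add: pos_divide_less_eq)
    then have l1: "1 < l"
      using pos(3) by simp
    define s where "s = nat \<lceil>2 * l\<rceil>"
    have s: "2 * l \<le> real s" "0 < s"
      unfolding s_def using l1 by (auto intro: of_nat_ceiling)
    define U where "U = \<Union>{X \<in> F. card X \<le> s}"
    have U: "real n / l / 2 \<le> real (card U)"
      unfolding U_def
    proof (rule card_small_packing[OF _ F s(2) big'])
      show "2 * real (card {..<n}) \<le> real n / l * real s"
        using s(1) l1 pos by (simp add: field_simps)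
    qed simp
    have "accept_prob orc (test_round n k s) \<le> 1 - real (card U) / (2 * real n)"
    proof (rule test_round_accept_prob_le)
      show "0 < n"
        using nm by simp
      show "U \<subseteq> {..<n}"
        using F(1) by (auto simp: U_def deficient_def proper_sets_def)
      fix v assume "v \<in> U"
      then obtain X where X: "X \<in> F" "v \<in> X" "card X \<le> s"
        by (auto simp: U_def)
      then have XE: "X \<in> deficient k {..<n} E"
        using F(1) by auto
      from E show "accept_prob orc (local_test Out_Edge n k s v) \<le> 1 / 2
        \<or> accept_prob orc (local_test In_Edge n k s v) \<le> 1 / 2"
      proof
        assume "E = parcs G"
        then have "accept_prob orc (local_test Out_Edge n k s v) \<le> 1 / 2"
          using inc by (intro local_test_finds[OF reads(1) _ _ XE X(2,3)])
            (simp_all add: incidence_lists_def)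
        then show ?thesis ..
      next
        assume "E = (parcs G)\<inverse>"
        then have "accept_prob orc (local_test In_Edge n k s v) \<le> 1 / 2"
          using inc by (intro local_test_finds[OF reads(2) _ _ XE X(2,3)])
            (simp_all add: incidence_lists_def)
        then show ?thesis ..
      qed
    qed
    also have "\<dots> \<le> 1 - 1 / (4 * l)"
      using U lpos pos by (simp add: field_simps)
    also have "\<dots> \<le> exp (- (1 / (4 * l)))"
      using exp_ge_add_one_self[of "- (1 / (4 * l))"] by simp
    finally have round: "accept_prob orc (test_round n k s) \<le> exp (- (1 / (4 * l)))" .
    define r where "r = nat \<lceil>8 * l\<rceil>"
    have r: "8 * l \<le> real r"
      unfolding r_def by (rule of_nat_ceiling)
    have "accept_prob orc (tester n m \<epsilon> k) = accept_prob orc (test_round n k s) ^ r"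
      using n1 False l1 by (simp add: tester_def Let_def l_def[symmetric] s_def r_def accept_prob_repeat)
    also have "\<dots> \<le> exp (- (1 / (4 * l))) ^ r"
      using round accept_prob_bounds(1) by (rule power_mono)
    also have "\<dots> = exp (- (real r / (4 * l)))"
      by (simp add: exp_of_nat_mult[symmetric])
    \<comment> \<open>Each round contributes \<open>1 / (4 * l)\<close> to the exponent, and there
      are at least \<open>8 * l\<close> rounds.\<close>
    also have "\<dots> \<le> exp (- 2)"
      using r lpos by (simp add: field_simps)
    also have "\<dots> \<le> 1 / 3"
    proof -
      have "3 \<le> exp (2 :: real)"
        using exp_ge_add_one_self[of 2] by simp
      then show ?thesis
        by (simp add: exp_minus field_simps)
    qed
    finally show ?thesis .
  qed
qed

lemma tester_queries:
  assumes G: "graph_input n m G orc" and nm: "1 \<le> n" "1 \<le> m" and eps: "0 < \<epsilon>" and k: "1 \<le> k"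
    and r: "r \<in> set_pmf (run orc (tester n m \<epsilon> k))"
  shows "real (snd r) \<le> 518400 * (real k ^ 5 / (\<epsilon> * (real m / real n)) ^ 3)"
proof -
  obtain outs ins where orc: "orc = answer outs ins"
    using G by (auto simp: graph_input_def)
  define l where "l = 4 * real k * real n / (\<epsilon> * real m)"
  have l_eq: "l = 4 * real k / (\<epsilon> * (real m / real n))"
    by (simp add: l_def)
  \<comment> \<open>\<open>l ^ 3\<close> supplies the factor 64, and
    \<open>518400 = 64 * 8100\<close>.\<close>
  have eq: "518400 * (real k ^ 5 / (\<epsilon> * (real m / real n)) ^ 3) = 8100 * (l ^ 3 * real k ^ 2)"
    unfolding l_eq by (simp add: power_divide power_mult_distrib eval_nat_numeral)
  have l0: "0 \<le> l"
    using eps by (simp add: l_def)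
  show ?thesis
  proof (cases "n = 1 \<or> n \<le> k \<or> l \<le> 1")
    case True
    then have "snd r = 0"
      using r by (auto simp: tester_def Let_def l_def[symmetric] split: if_splits)
    then show ?thesis
      unfolding eq using l0 by simp
  next
    case False
    define s R where "s = nat \<lceil>2 * l\<rceil>" and "R = nat \<lceil>8 * l\<rceil>"
    have l1: "1 < l"
      using False by simp
    \<comment> \<open>Rounding up adds at most 1, which is less than \<open>l\<close>.\<close>
    have s: "real s \<le> 3 * l" "1 \<le> real s" and R: "real R \<le> 9 * l"
      unfolding s_def R_def using l1 by linarith+
    have "queries_le orc (search_size k s * (s + k) + search_size k s * (s + k))
        (both (local_test Out_Edge n k s v) (local_test In_Edge n k s v))" for v
    proof (rule queries_le_both)
      show "queries_le orc (search_size k s * (s + k)) (local_test Out_Edge n k s v)"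
        by (rule local_test_queries_le[of _ _ outs]) (simp add: orc reads_def)
      show "queries_le orc (search_size k s * (s + k)) (local_test In_Edge n k s v)"
        by (rule local_test_queries_le[of _ _ ins]) (simp add: orc reads_def)
    qed
    then have "queries_le orc (R * (search_size k s * (s + k) + search_size k s * (s + k)))
        (repeat_alg R (test_round n k s))"
      unfolding test_round_def by (intro queries_le_repeat queries_le_Draw)
    moreover have "tester n m \<epsilon> k = repeat_alg R (test_round n k s)"
      using False by (simp add: tester_def Let_def l_def[symmetric] s_def R_def)
    ultimately have "snd r \<le> R * (2 * (search_size k s * (s + k)))"
      using r by (auto simp: queries_le_def mult_2)
    then have "real (snd r) \<le> real (R * (2 * (search_size k s * (s + k))))"
      by (rule of_nat_mono)
    also have "\<dots> = real R * (2 * (real (search_size k s) * real (s + k)))"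
      by simp
    \<comment> \<open>25 comes from \<open>8 * s * (k + 2) + s = 8 * s * k + 17 * s\<close>; the
      first 2 counts the two directions, the second one bounds \<open>s + k\<close>.\<close>
    also have "\<dots> \<le> (9 * l) * (2 * ((25 * (real s * real k)) * (2 * (real s * real k))))"
    proof (intro mult_mono R)
      have k1: "1 \<le> real k"
        using k by simp
      have sk: "real s \<le> real s * real k" "real k \<le> real s * real k"
        using k1 s(2) mult_left_mono[of 1 "real k" "real s"] mult_right_mono[of 1 "real s" "real k"] by auto
      show "real (search_size k s) \<le> 25 * (real s * real k)"
        using sk(1) by (simp add: search_size_def algebra_simps)
      show "real (s + k) \<le> 2 * (real s * real k)"
        using sk by simp
    qed (use l0 in auto)
    also have "\<dots> = 900 * l * real k ^ 2 * real s ^ 2"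
      by (simp add: power2_eq_square)
    also have "\<dots> \<le> 900 * l * real k ^ 2 * (3 * l) ^ 2"
      using s l0 by (intro mult_left_mono power_mono) auto
    also have "\<dots> = 8100 * (l ^ 3 * real k ^ 2)"
      by (simp add: power2_eq_square power3_eq_cube)
    finally show ?thesis
      unfolding eq .
  qed
qed

theorem theorem25:
  shows "\<exists>(C::real) (T :: nat \<Rightarrow> nat \<Rightarrow> real \<Rightarrow> nat \<Rightarrow> query_alg). C > 0 \<and>
    (\<forall>(n::nat) (m::nat) (\<epsilon>::real) (k::nat). n \<ge> 1 \<and> m \<ge> 1 \<and> \<epsilon> > 0 \<and> k \<ge> 1 \<longrightarrow>
       property_tester n m \<epsilon> k (T n m \<epsilon> k) \<and>
       one_sided n m k (T n m \<epsilon> k) \<and>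
       false_reject_at_most (1/3) n m k (T n m \<epsilon> k) \<and>
       queries_at_most (C * (real k ^ 5 / (\<epsilon> * (real m / real n)) ^ 3)) n m (T n m \<epsilon> k))"
proof (intro exI[of _ 518400] exI[of _ tester] conjI allI impI)
  show "0 < (518400 :: real)"
    by simp
  fix n m :: nat and \<epsilon> :: real and k :: nat
  assume A: "n \<ge> 1 \<and> m \<ge> 1 \<and> \<epsilon> > 0 \<and> k \<ge> 1"
  have acc: "accept_prob orc (tester n m \<epsilon> k) = 1"
    if "graph_input n m G orc" "k_edge_connected k G" for G orc
    using tester_accepts[OF that(1) _ that(2)] A by blast
  have rej: "accept_prob orc (tester n m \<epsilon> k) \<le> 1 / 3"
    if "graph_input n m G orc" "far_from_k_edge_connected \<epsilon> k G" for G orc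
    using tester_accept_prob_le[OF that(1) _ _ _ _ that(2)] A by blast
  show "property_tester n m \<epsilon> k (tester n m \<epsilon> k)"
    unfolding property_tester_def reject_prob_eq using acc rej by fastforce
  show "one_sided n m k (tester n m \<epsilon> k)"
    unfolding one_sided_def using acc by blast
  show "false_reject_at_most (1/3) n m k (tester n m \<epsilon> k)"
    unfolding false_reject_at_most_def reject_prob_eq using acc by simp
  show "queries_at_most (518400 * (real k ^ 5 / (\<epsilon> * (real m / real n)) ^ 3)) n m (tester n m \<epsilon> k)"
    unfolding queries_at_most_def using tester_queries A by blast
qed

end
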